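(* Let $\psi:\Sigma\to\mathbb{R}^3$ be an indefinite improper affine sphere with constant affine normal $\xi$ and affine conormal $N$. Let $I\subset\mathbb{R}$ be an interval, $\beta:I\to\Sigma$ a regular analytic curve, $\alpha=\psi\circ\beta$ and $U=N\circ\beta$. Then $\alpha$ is a pre-geodesic for the affine metric if and only if $$[\alpha',\alpha'',\xi]=[U,U',U'']\qquad\text{on } I.$$
   Context: $\langle\cdot,\cdot\rangle$ is the standard inner product of $\mathbb{R}^3$, $[\cdot,\cdot,\cdot]$ the determinant, and a prime denotes differentiation with respect to the parameter of the curve. An indefinite improper affine sphere with (constant) affine normal $\xi$ is an immersion $\psi:\Sigma\to\mathbb{R}^3$ of a surface, transversal to the constant vector $\xi\neq0$, such that the symmetric bilinear form $h$ (the affine metric) defined by $D_X d\psi(Y)=d\psi(\nabla_XY)+h(X,Y)\xi$, with $D$ the flat connection of $\mathbb{R}^3$, is a Lorentzian metric and $\sqrt{h(X,Y)^2-h(X,X)h(Y,Y)}=|[d\psi(X),d\psi(Y),\xi]|$ for all tangent vectors $X,Y$. The affine conormal is the map $N:\Sigma\to\mathbb{R}^3$ determined by $\langle N,\xi\rangle=1$, $\langle N,d\psi\rangle=0$; one has $h=-\langle dN,d\psi\rangle$. The curve $\alpha$ is a pre-geodesic for the affine metric if $\nabla^h_{\beta'}\beta'$ is proportional to $\beta'$ along $\beta$, where $\nabla^h$ is the Levi-Civita connection of $h$. *)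

theory Defs
  imports "HOL-Analysis.Analysis"
begin

definition bracket :: "real^3 \<Rightarrow> real^3 \<Rightarrow> real^3 \<Rightarrow> real" where
  "bracket a b c = det (vector [a, b, c] :: real^3^3)"

(* Near every point of S, f agrees on S with a convergent multivariate power series; the
   multi-indices k are the functions Basis -> nat. For open S this is the usual notion; for a
   non-open interval it includes one-sided power series at the end points. *)
definition real_analytic_on ::
    "('a::euclidean_space \<Rightarrow> 'b::real_normed_vector) \<Rightarrow> 'a set \<Rightarrow> bool" where
  "real_analytic_on f S \<longleftrightarrow>
     (\<forall>p\<in>S. \<exists>a r. r > 0 \<and>
        (\<forall>x\<in>S. dist x p < r \<longrightarrow>
           ((\<lambda>k. (\<Prod>b\<in>Basis. ((x - p) \<bullet> b) ^ k b) *\<^sub>R a k) has_sum f x)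
             (Basis \<rightarrow>\<^sub>E (UNIV :: nat set))))"

(* Meant for open S. *)
primrec Ck_on ::
    "nat \<Rightarrow> ('a::euclidean_space \<Rightarrow> 'b::real_normed_vector) \<Rightarrow> 'a set \<Rightarrow> bool" where
  "Ck_on 0 f S \<longleftrightarrow> continuous_on S f"
| "Ck_on (Suc n) f S \<longleftrightarrow>
     (\<forall>x\<in>S. f differentiable (at x)) \<and>
     (\<forall>v. Ck_on n (\<lambda>x. frechet_derivative f (at x) v) S)"

definition smooth_on ::
    "('a::euclidean_space \<Rightarrow> 'b::real_normed_vector) \<Rightarrow> 'a set \<Rightarrow> bool" where
  "smooth_on f S \<longleftrightarrow> (\<forall>n. Ck_on n f S)"

(* A chart is a pair of its domain and its coordinate map; the values of the latter outside the
   domain are irrelevant. *)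
type_synonym 'p chart = "'p set \<times> ('p \<Rightarrow> real^2)"

definition chart_image :: "'p chart \<Rightarrow> (real^2) set" where
  "chart_image c = snd c ` fst c"

definition in_chart :: "'p chart \<Rightarrow> ('p \<Rightarrow> 'b) \<Rightarrow> real^2 \<Rightarrow> 'b" where
  "in_chart c F = F \<circ> inv_into (fst c) (snd c)"

definition is_chart :: "'p topology \<Rightarrow> 'p chart \<Rightarrow> bool" where
  "is_chart M c \<longleftrightarrow>
     openin M (fst c) \<and> open (chart_image c) \<and>
     homeomorphic_map (subtopology M (fst c)) (top_of_set (chart_image c)) (snd c)"

(* The analytic structure is what gives a meaning to analytic curves in the surface. *)
definition analytic_surface :: "'p topology \<Rightarrow> 'p chart set \<Rightarrow> bool" where
  "analytic_surface M A \<longleftrightarrow>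
     Hausdorff_space M \<and> second_countable M \<and>
     (\<forall>c\<in>A. is_chart M c) \<and> topspace M = (\<Union>c\<in>A. fst c) \<and>
     (\<forall>c\<in>A. \<forall>d\<in>A. real_analytic_on (in_chart c (snd d)) (snd c ` (fst c \<inter> fst d)))"

definition smooth_immersion :: "'p chart set \<Rightarrow> ('p \<Rightarrow> real^3) \<Rightarrow> bool" where
  "smooth_immersion A \<psi> \<longleftrightarrow>
     (\<forall>c\<in>A. smooth_on (in_chart c \<psi>) (chart_image c) \<and>
        (\<forall>x\<in>chart_image c. inj (frechet_derivative (in_chart c \<psi>) (at x))))"

definition transversal :: "'p chart set \<Rightarrow> ('p \<Rightarrow> real^3) \<Rightarrow> real^3 \<Rightarrow> bool" where
  "transversal A \<psi> \<xi> \<longleftrightarrow>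
     (\<forall>c\<in>A. \<forall>x\<in>chart_image c. \<xi> \<notin> range (frechet_derivative (in_chart c \<psi>) (at x)))"

(* In a chart, an affine connection is D_X Y + G(X, Y), with D the coordinate derivative and G the
   bilinear form of its Christoffel symbols. *)
definition connection ::
    "(real^2 \<Rightarrow> real^2 \<Rightarrow> real^2 \<Rightarrow> real^2) \<Rightarrow>
     (real^2 \<Rightarrow> real^2) \<Rightarrow> (real^2 \<Rightarrow> real^2) \<Rightarrow> real^2 \<Rightarrow> real^2" where
  "connection G X Y x = frechet_derivative Y (at x) (X x) + G x (X x) (Y x)"

(* D_X d\<psi>(Y) = d\<psi>(\<nabla>_X Y) + h(X, Y) \<xi>, read in each chart. Since \<psi> is an immersion and \<xi> is
   transversal, this determines the components h c of the affine metric on the image of each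
   chart c. *)
definition affine_metric ::
    "'p chart set \<Rightarrow> ('p \<Rightarrow> real^3) \<Rightarrow> real^3 \<Rightarrow>
     ('p chart \<Rightarrow> real^2 \<Rightarrow> real^2 \<Rightarrow> real^2 \<Rightarrow> real) \<Rightarrow> bool" where
  "affine_metric A \<psi> \<xi> h \<longleftrightarrow>
     (\<forall>c\<in>A. \<exists>G. (\<forall>x\<in>chart_image c. bilinear (G x)) \<and>
        (\<forall>X Y. smooth_on X (chart_image c) \<longrightarrow> smooth_on Y (chart_image c) \<longrightarrow>
          (\<forall>x\<in>chart_image c.
             frechet_derivative (\<lambda>y. frechet_derivative (in_chart c \<psi>) (at y) (Y y)) (at x) (X x)
             = frechet_derivative (in_chart c \<psi>) (at x) (connection G X Y x)
               + h c x (X x) (Y x) *\<^sub>R \<xi>)))"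

(* Signature (1,1), expressed by an orthonormal basis of the plane. *)
definition lorentzian :: "(real^2 \<Rightarrow> real^2 \<Rightarrow> real) \<Rightarrow> bool" where
  "lorentzian g \<longleftrightarrow>
     bilinear g \<and> (\<forall>v w. g v w = g w v) \<and>
     (\<exists>e\<^sub>1 e\<^sub>2. g e\<^sub>1 e\<^sub>1 = 1 \<and> g e\<^sub>2 e\<^sub>2 = -1 \<and> g e\<^sub>1 e\<^sub>2 = 0)"

definition indefinite_improper_affine_sphere ::
    "'p chart set \<Rightarrow> ('p \<Rightarrow> real^3) \<Rightarrow> real^3 \<Rightarrow>
     ('p chart \<Rightarrow> real^2 \<Rightarrow> real^2 \<Rightarrow> real^2 \<Rightarrow> real) \<Rightarrow> bool" where
  "indefinite_improper_affine_sphere A \<psi> \<xi> h \<longleftrightarrow>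
     smooth_immersion A \<psi> \<and> \<xi> \<noteq> 0 \<and> transversal A \<psi> \<xi> \<and> affine_metric A \<psi> \<xi> h \<and>
     (\<forall>c\<in>A. \<forall>x\<in>chart_image c. lorentzian (h c x) \<and>
        (\<forall>v w. sqrt ((h c x v w)\<^sup>2 - h c x v v * h c x w w)
           = \<bar>bracket (frechet_derivative (in_chart c \<psi>) (at x) v)
                     (frechet_derivative (in_chart c \<psi>) (at x) w) \<xi>\<bar>))"

definition affine_conormal ::
    "'p chart set \<Rightarrow> ('p \<Rightarrow> real^3) \<Rightarrow> real^3 \<Rightarrow> ('p \<Rightarrow> real^3) \<Rightarrow> bool" where
  "affine_conormal A \<psi> \<xi> N \<longleftrightarrow>
     (\<forall>c\<in>A. \<forall>x\<in>chart_image c. in_chart c N x \<bullet> \<xi> = 1 \<and>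
        (\<forall>v. in_chart c N x \<bullet> frechet_derivative (in_chart c \<psi>) (at x) v = 0))"

(* The torsion-free metric connection of g on the open set S. *)
definition levi_civita ::
    "(real^2) set \<Rightarrow> (real^2 \<Rightarrow> real^2 \<Rightarrow> real^2 \<Rightarrow> real) \<Rightarrow>
     (real^2 \<Rightarrow> real^2 \<Rightarrow> real^2 \<Rightarrow> real^2) \<Rightarrow> bool" where
  "levi_civita S g G \<longleftrightarrow>
     (\<forall>x\<in>S. bilinear (G x)) \<and>
     (\<forall>X Y. smooth_on X S \<longrightarrow> smooth_on Y S \<longrightarrow>
        (\<forall>x\<in>S. connection G X Y x - connection G Y X x
           = frechet_derivative Y (at x) (X x) - frechet_derivative X (at x) (Y x))) \<and>
     (\<forall>X Y Z. smooth_on X S \<longrightarrow> smooth_on Y S \<longrightarrow> smooth_on Z S \<longrightarrow>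
        (\<forall>x\<in>S. frechet_derivative (\<lambda>y. g y (Y y) (Z y)) (at x) (X x)
           = g x (connection G X Y x) (Z x) + g x (Y x) (connection G X Z x)))"

(* One-sided at the end points of I. *)
definition prime_on :: "real set \<Rightarrow> (real \<Rightarrow> 'b::real_normed_vector) \<Rightarrow> real \<Rightarrow> 'b" where
  "prime_on I \<gamma> t = vector_derivative \<gamma> (at t within I)"

definition regular_analytic_curve ::
    "'p topology \<Rightarrow> 'p chart set \<Rightarrow> real set \<Rightarrow> (real \<Rightarrow> 'p) \<Rightarrow> bool" where
  "regular_analytic_curve M A I \<beta> \<longleftrightarrow>
     continuous_map (top_of_set I) M \<beta> \<and>
     (\<forall>c\<in>A. real_analytic_on (snd c \<circ> \<beta>) {t\<in>I. \<beta> t \<in> fst c} \<and>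
        (\<forall>t\<in>I. \<beta> t \<in> fst c \<longrightarrow> prime_on I (snd c \<circ> \<beta>) t \<noteq> 0))"

(* The covariant derivative of \<gamma>' along \<gamma>, for a curve \<gamma> given in a chart. *)
definition curve_acceleration ::
    "(real^2 \<Rightarrow> real^2 \<Rightarrow> real^2 \<Rightarrow> real^2) \<Rightarrow> real set \<Rightarrow> (real \<Rightarrow> real^2) \<Rightarrow> real \<Rightarrow> real^2" where
  "curve_acceleration G I \<gamma> t =
     prime_on I (prime_on I \<gamma>) t + G (\<gamma> t) (prime_on I \<gamma> t) (prime_on I \<gamma> t)"

definition pre_geodesic ::
    "'p chart set \<Rightarrow> ('p chart \<Rightarrow> real^2 \<Rightarrow> real^2 \<Rightarrow> real^2 \<Rightarrow> real) \<Rightarrow>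
     real set \<Rightarrow> (real \<Rightarrow> 'p) \<Rightarrow> bool" where
  "pre_geodesic A h I \<beta> \<longleftrightarrow>
     (\<exists>G. (\<forall>c\<in>A. levi_civita (chart_image c) (h c) (G c)) \<and>
        (\<forall>c\<in>A. \<forall>t\<in>I. \<beta> t \<in> fst c \<longrightarrow>
           (\<exists>\<mu>::real. curve_acceleration (G c) I (snd c \<circ> \<beta>) t
              = \<mu> *\<^sub>R prime_on I (snd c \<circ> \<beta>) t)))"

end

theory Submission
  imports Defs
begin

text \<open>
Write \<open>L = d\<psi>\<close> in a chart, \<open>D\<^sub>vL(w) = L(C(v, w)) + h(v, w) \<xi>\<close>, and let \<open>v\<close> be the velocity of the
curve in the chart, \<open>b = v' + C(v, v)\<close>, and \<open>a = v' + G(v, v)\<close> for the Levi-Civita connection \<open>G\<close>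
of \<open>h\<close>. Then \<open>\<alpha>' = L v\<close> and \<open>\<alpha>'' = L b + h(v, v) \<xi>\<close>, while \<open>U' \<bullet> L w = - h(v, w)\<close>. Differentiating
the last identity and using the Codazzi equation gives \<open>U'' \<bullet> L w = h(b - 2a, w)\<close>,
because \<open>G\<close> is the mean of \<open>C\<close> and the connection conjugate to it with respect to \<open>h\<close>. Since
\<open>h(v, w)\<^sup>2 - h(v, v) h(w, w) = \<omega>(v, w)\<^sup>2\<close> for \<open>\<omega>(v, w) = [L v, L w, \<xi>]\<close>, this yields
\<open>[U, U', U''] = \<omega>(v, b - 2a) = [\<alpha>', \<alpha>'', \<xi>] - 2 \<omega>(v, a)\<close>, so the two brackets agree exactly
where \<open>a\<close> is proportional to \<open>v\<close>.
\<close>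

subsection \<open>Symmetry of second derivatives\<close>

text \<open>Two applications of the mean value theorem: first along \<open>v\<close> to the
  increment of \<open>f\<close> in the direction \<open>s w\<close>, then along \<open>w\<close> to
  the derivative of \<open>f\<close> in the direction \<open>v\<close>. Each supplies one
  intermediate parameter, and together these give the point \<open>y\<close> of the
  parallelogram.\<close>

lemma second_difference_mvt:
  fixes f :: "'a::real_normed_vector \<Rightarrow> real"
  assumes f: "\<And>y. y \<in> ball x r \<Longrightarrow> f differentiable (at y)"
    and fv: "\<And>y. y \<in> ball x r \<Longrightarrow> (\<lambda>z. frechet_derivative f (at z) v) differentiable (at y)"
    and s: "0 < s" "s * (norm v + norm w) < r"
  obtains y where "y \<in> ball x r"
    "f (x + s *\<^sub>R v + s *\<^sub>R w) - f (x + s *\<^sub>R v) - f (x + s *\<^sub>R w) + f x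
      = s\<^sup>2 * frechet_derivative (\<lambda>z. frechet_derivative f (at z) v) (at y) w"
proof -
  have near: "x + a *\<^sub>R v + b *\<^sub>R w \<in> ball x r" if "0 \<le> a" "a \<le> s" "0 \<le> b" "b \<le> s" for a b
  proof -
    have "dist x (x + a *\<^sub>R v + b *\<^sub>R w) = norm (a *\<^sub>R v + b *\<^sub>R w)"
      by (metis add.assoc add_diff_cancel_left' dist_commute dist_norm)
    also have "\<dots> \<le> norm (a *\<^sub>R v) + norm (b *\<^sub>R w)"
      by (rule norm_triangle_ineq)
    also have "\<dots> \<le> s * norm v + s * norm w"
      using that by (auto intro!: add_mono mult_right_mono)
    finally show ?thesis using s(2) by (simp add: algebra_simps)
  qed
  have v_line: "((\<lambda>t. f (x + t *\<^sub>R v + b *\<^sub>R w)) has_real_derivative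
      frechet_derivative f (at (x + a *\<^sub>R v + b *\<^sub>R w)) v) (at a)"
    if "0 \<le> a" "a \<le> s" "0 \<le> b" "b \<le> s" for a b
  proof -
    have F: "(f has_derivative frechet_derivative f (at (x + a *\<^sub>R v + b *\<^sub>R w)))
        (at (x + a *\<^sub>R v + b *\<^sub>R w))"
      using f[OF near[OF that]] frechet_derivative_works by blast
    have "((\<lambda>t. x + t *\<^sub>R v + b *\<^sub>R w) has_derivative (\<lambda>t. t *\<^sub>R v)) (at a)"
      by (auto intro!: derivative_eq_intros)
    from has_derivative_compose[OF this F] show ?thesis
      unfolding has_field_derivative_def
      by (simp add: linear_cmul[OF has_derivative_linear[OF F]] mult_commute_abs)
  qed
  have w_line: "((\<lambda>t. frechet_derivative f (at (x + a *\<^sub>R v + t *\<^sub>R w)) v) has_real_derivative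
      frechet_derivative (\<lambda>z. frechet_derivative f (at z) v) (at (x + a *\<^sub>R v + b *\<^sub>R w)) w) (at b)"
    if "0 \<le> a" "a \<le> s" "0 \<le> b" "b \<le> s" for a b
  proof -
    let ?D = "frechet_derivative (\<lambda>z. frechet_derivative f (at z) v) (at (x + a *\<^sub>R v + b *\<^sub>R w))"
    have F: "((\<lambda>z. frechet_derivative f (at z) v) has_derivative ?D) (at (x + a *\<^sub>R v + b *\<^sub>R w))"
      using fv[OF near[OF that]] frechet_derivative_works by blast
    have "((\<lambda>t. x + a *\<^sub>R v + t *\<^sub>R w) has_derivative (\<lambda>t. t *\<^sub>R w)) (at b)"
      by (auto intro!: derivative_eq_intros)
    from has_derivative_compose[OF this F] show ?thesis
      unfolding has_field_derivative_def
      by (simp add: linear_cmul[OF has_derivative_linear[OF F]] mult_commute_abs)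
  qed
  \<comment> \<open>The summand \<open>0 *\<^sub>R w\<close> gives both terms the shape required by
    \<open>v_line\<close>, with the second parameter equal to \<open>s\<close> and to 0.\<close>
  define p where "p t = f (x + t *\<^sub>R v + s *\<^sub>R w) - f (x + t *\<^sub>R v + 0 *\<^sub>R w)" for t
  have dp: "(p has_real_derivative (frechet_derivative f (at (x + a *\<^sub>R v + s *\<^sub>R w)) v
        - frechet_derivative f (at (x + a *\<^sub>R v + 0 *\<^sub>R w)) v)) (at a)"
    if "0 \<le> a" "a \<le> s" for a
    unfolding p_def using that s(1) by (intro DERIV_diff v_line) auto
  obtain a where a: "0 < a" "a < s" and pa: "p s - p 0 = (s - 0) *
      (frechet_derivative f (at (x + a *\<^sub>R v + s *\<^sub>R w)) v
        - frechet_derivative f (at (x + a *\<^sub>R v + 0 *\<^sub>R w)) v)"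
    using MVT2[OF s(1) dp] by blast
  have dw: "((\<lambda>t. frechet_derivative f (at (x + a *\<^sub>R v + t *\<^sub>R w)) v) has_real_derivative
      frechet_derivative (\<lambda>z. frechet_derivative f (at z) v) (at (x + a *\<^sub>R v + b *\<^sub>R w)) w) (at b)"
    if "0 \<le> b" "b \<le> s" for b
    by (rule w_line) (use a that in auto)
  obtain b where b: "0 < b" "b < s" and "frechet_derivative f (at (x + a *\<^sub>R v + s *\<^sub>R w)) v
        - frechet_derivative f (at (x + a *\<^sub>R v + 0 *\<^sub>R w)) v
      = (s - 0) * frechet_derivative (\<lambda>z. frechet_derivative f (at z) v)
          (at (x + a *\<^sub>R v + b *\<^sub>R w)) w"
    using MVT2[OF s(1) dw] by blast
  with pa have "p s - p 0 = s\<^sup>2 * frechet_derivative (\<lambda>z. frechet_derivative f (at z) v)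
          (at (x + a *\<^sub>R v + b *\<^sub>R w)) w"
    by (simp add: power2_eq_square)
  moreover have "x + a *\<^sub>R v + b *\<^sub>R w \<in> ball x r"
    by (rule near) (use a b in auto)
  ultimately show thesis
    using that[of "x + a *\<^sub>R v + b *\<^sub>R w"] by (simp add: p_def)
qed

text \<open>The second difference is symmetric in \<open>v\<close> and \<open>w\<close>, so on every
  small parallelogram the two mixed derivatives attain a common value, possibly at different points.
  Continuity at \<open>x\<close> then forces them to agree there.\<close>

lemma frechet_derivative_symmetric_real:
  fixes f :: "'a::real_normed_vector \<Rightarrow> real"
  assumes S: "open S" "x \<in> S"
    and f: "\<And>y. y \<in> S \<Longrightarrow> f differentiable (at y)"
    and f1: "\<And>y u. y \<in> S \<Longrightarrow> (\<lambda>z. frechet_derivative f (at z) u) differentiable (at y)"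
    and f2: "\<And>u u'. continuous_on S
        (\<lambda>y. frechet_derivative (\<lambda>z. frechet_derivative f (at z) u) (at y) u')"
  shows "frechet_derivative (\<lambda>z. frechet_derivative f (at z) v) (at x) w
       = frechet_derivative (\<lambda>z. frechet_derivative f (at z) w) (at x) v"
proof -
  define A where "A y = frechet_derivative (\<lambda>z. frechet_derivative f (at z) v) (at y) w" for y
  define B where "B y = frechet_derivative (\<lambda>z. frechet_derivative f (at z) w) (at y) v" for y
  have "A x = B x"
  proof (rule ccontr)
    assume "A x \<noteq> B x"
    \<comment> \<open>Half the gap: no number is closer than \<open>e\<close> to both
      \<open>A x\<close> and \<open>B x\<close>.\<close>
    define e where "e = \<bar>A x - B x\<bar> / 2"
    have e: "e > 0" using \<open>A x \<noteq> B x\<close> by (simp add: e_def)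
    obtain dA where dA: "dA > 0" "\<And>y. y \<in> S \<Longrightarrow> dist y x < dA \<Longrightarrow> dist (A y) (A x) < e"
      using f2[of v w] S(2) e unfolding continuous_on_iff A_def by blast
    obtain dB where dB: "dB > 0" "\<And>y. y \<in> S \<Longrightarrow> dist y x < dB \<Longrightarrow> dist (B y) (B x) < e"
      using f2[of w v] S(2) e unfolding continuous_on_iff B_def by blast
    obtain d where d: "d > 0" "ball x d \<subseteq> S"
      using S open_contains_ball by blast
    define r where "r = min d (min dA dB)"
    have r: "r > 0" "ball x r \<subseteq> S" using dA dB d by (auto simp: r_def)
    \<comment> \<open>The summand 1 keeps the denominator positive even when \<open>v\<close> and
      \<open>w\<close> both vanish.\<close>
    define s where "s = r / (2 * (norm v + norm w + 1))"
    have pos: "norm v + norm w + 1 > 0" by (smt (verit) norm_ge_zero)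
    have s: "s > 0" using r pos by (simp add: s_def)
    have "s * (norm v + norm w) < s * (2 * (norm v + norm w + 1))"
      using s pos by (intro mult_strict_left_mono) auto
    also have "\<dots> = r" using pos by (simp add: s_def)
    finally have sr: "s * (norm v + norm w) < r" .
    then have sr': "s * (norm w + norm v) < r" by (simp add: add.commute)
    obtain y where y: "y \<in> ball x r" and Ay:
      "f (x + s *\<^sub>R v + s *\<^sub>R w) - f (x + s *\<^sub>R v) - f (x + s *\<^sub>R w) + f x = s\<^sup>2 * A y"
      unfolding A_def
      by (rule second_difference_mvt[where f = f and x = x and r = r and v = v and w = w and s = s])
        (use f f1 r s sr in auto)
    obtain z where z: "z \<in> ball x r" and Bz:
      "f (x + s *\<^sub>R w + s *\<^sub>R v) - f (x + s *\<^sub>R w) - f (x + s *\<^sub>R v) + f x = s\<^sup>2 * B z"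
      unfolding B_def
      by (rule second_difference_mvt[where f = f and x = x and r = r and v = w and w = v and s = s])
        (use f f1 r s sr' in auto)
    have yr: "dist y x < r" using y by (simp add: dist_commute)
    have zr: "dist z x < r" using z by (simp add: dist_commute)
    have yS: "y \<in> S" using y r by blast
    have zS: "z \<in> S" using z r by blast
    have "s\<^sup>2 * A y = s\<^sup>2 * B z"
      unfolding Ay[symmetric] Bz[symmetric] by (simp add: algebra_simps)
    then have "A y = B z" using s by simp
    moreover have "dist (A y) (A x) < e" using dA(2)[OF yS] yr by (simp add: r_def)
    moreover have "dist (B z) (B x) < e" using dB(2)[OF zS] zr by (simp add: r_def)
    ultimately show False unfolding e_def dist_real_def by (smt (verit) field_sum_of_halves)
  qed
  then show ?thesis by (simp add: A_def B_def)
qed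

subsection \<open>Analytic curves\<close>

text \<open>On the real line \<open>Basis\<close> is a singleton, so a multi-index is a single
  natural number. Reindexing turns the unordered sum over multi-indices into an ordinary power
  series.\<close>

lemma real_analytic_on_power_series:
  fixes f :: "real \<Rightarrow> 'b::real_normed_vector"
  assumes "real_analytic_on f S" "p \<in> S"
  obtains a r where "r > 0"
    "\<And>x. x \<in> S \<Longrightarrow> dist x p < r \<Longrightarrow> (\<lambda>n. (x - p) ^ n *\<^sub>R a n) sums f x"
proof -
  obtain a r where r: "r > 0" and a: "\<And>x. x \<in> S \<Longrightarrow> dist x p < r \<Longrightarrow>
      ((\<lambda>k. (\<Prod>b\<in>Basis. ((x - p) \<bullet> b) ^ k b) *\<^sub>R a k) has_sum f x) (Basis \<rightarrow>\<^sub>E (UNIV :: nat set))"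
    using assms unfolding real_analytic_on_def by blast
  \<comment> \<open>The restricted abstraction makes \<open>e n\<close> extensional, as membership
    in the function space over \<open>Basis\<close> demands.\<close>
  define e where "e n = (\<lambda>b\<in>{1::real}. n)" for n :: nat
  have "bij_betw e UNIV (Basis \<rightarrow>\<^sub>E UNIV)"
  proof (rule bij_betwI[where g = "\<lambda>k. k 1"])
    show "e (k 1) = k" if "k \<in> Basis \<rightarrow>\<^sub>E UNIV" for k
      using that by (auto simp: e_def PiE_iff extensional_def fun_eq_iff)
  qed (auto simp: e_def)
  note reindex = has_sum_reindex_bij_betw[OF this]
  show thesis
  proof (rule that[OF r])
    fix x assume x: "x \<in> S" "dist x p < r"
    from a[OF this, folded reindex] show "(\<lambda>n. (x - p) ^ n *\<^sub>R a (e n)) sums f x"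
      by (intro has_sum_imp_sums) (simp add: e_def)
  qed
qed

text \<open>The power series at \<open>p\<close> extends \<open>f\<close> to a full neighbourhood of
  \<open>p\<close>, where it can be differentiated termwise. That \<open>J\<close> has no isolated
  points is used twice: it provides a point other than \<open>p\<close> at which the series
  converges, hence a positive radius of convergence, and it makes derivatives within
  \<open>J\<close> unique.\<close>

lemma real_analytic_on_twice_differentiable:
  fixes f :: "real \<Rightarrow> 'b::euclidean_space"
  assumes f: "real_analytic_on f J" and J: "\<And>q. q \<in> J \<Longrightarrow> q islimpt J" and p: "p \<in> J"
  shows "f differentiable (at p within J)"
    and "(\<lambda>s. vector_derivative f (at s within J)) differentiable (at p within J)"
proof -
  obtain a r where r: "r > 0" and
    a: "\<And>x. x \<in> J \<Longrightarrow> dist x p < r \<Longrightarrow> (\<lambda>n. (x - p) ^ n *\<^sub>R a n) sums f x"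
    using real_analytic_on_power_series[OF f p] by blast
  obtain x0 where x0: "x0 \<in> J" "x0 \<noteq> p" "dist x0 p < r"
    using J[OF p] r unfolding islimpt_approachable by blast
  define \<rho> where "\<rho> = dist x0 p"
  have \<rho>: "\<rho> > 0" "\<rho> < r" using x0 by (auto simp: \<rho>_def)
  \<comment> \<open>Termwise differentiation is applied to the scalar series of each coordinate.
    \<open>F d\<close> reassembles the series differentiated \<open>d\<close> times.\<close>
  define c where "c b n = a n \<bullet> b" for b n
  define F where "F d x = (\<Sum>b\<in>Basis. (\<Sum>n. (diffs ^^ d) (c b) n * (x - p) ^ n) *\<^sub>R b)" for d x
  have coord: "(\<lambda>n. c b n * (x - p) ^ n) sums (f x \<bullet> b)" if "x \<in> J" "dist x p < r" for x b
    using bounded_linear.sums[OF bounded_linear_inner_left a[OF that], of b]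
    by (simp add: c_def mult.commute)
  have summ: "summable (\<lambda>n. (diffs ^^ d) (c b) n * y ^ n)" if "norm y < \<rho>" for d b y
    using that
  proof (induction d arbitrary: y)
    case 0
    have "summable (\<lambda>n. c b n * (x0 - p) ^ n)" using coord[OF x0(1,3)] by (rule sums_summable)
    then show ?case using 0 by (simp, elim powser_inside) (simp add: \<rho>_def dist_norm)
  next
    case (Suc d)
    then show ?case using termdiff_converges[OF Suc.prems, of "(diffs ^^ d) (c b)"] by simp
  qed
  have F: "(F d has_vector_derivative F (Suc d) x) (at x)" if "dist x p < \<rho>" for d x
  proof -
    have "((\<lambda>y. \<Sum>n. (diffs ^^ d) (c b) n * (y - p) ^ n) has_real_derivative
        (\<Sum>n. (diffs ^^ Suc d) (c b) n * (x - p) ^ n)) (at x)" for b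
    proof -
      have "((\<lambda>y. \<Sum>n. (diffs ^^ d) (c b) n * y ^ n) has_real_derivative
        (\<Sum>n. (diffs ^^ Suc d) (c b) n * (x - p) ^ n)) (at (x + - p))"
        using termdiffs_strong'[of \<rho> "(diffs ^^ d) (c b)" "x - p"] summ that
        by (simp add: dist_norm)
      then show ?thesis using DERIV_shift[of _ _ x "- p"] by simp
    qed
    then show ?thesis unfolding F_def
      by (auto intro!: has_vector_derivative_sum derivative_eq_intros)
  qed
  have eq: "F 0 x = f x" if "x \<in> J" "dist x p < \<rho>" for x
  proof -
    have "(\<Sum>n. c b n * (x - p) ^ n) = f x \<bullet> b" for b
      using coord[of x b] that \<rho> by (simp add: sums_iff)
    then show ?thesis unfolding F_def by (simp add: euclidean_representation)
  qed
  \<comment> \<open>The first derivative is identified at all points of \<open>J\<close> near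
    \<open>p\<close>, not only at \<open>p\<close>, because it has to be differentiated once
    more.\<close>
  have f1: "(f has_vector_derivative F 1 x) (at x within J)" if x: "x \<in> J" "dist x p < \<rho>" for x
  proof (rule has_vector_derivative_transform_within[OF _ _ x(1)])
    show "(F 0 has_vector_derivative F 1 x) (at x within J)"
      using F[of x 0] x(2) by (simp add: has_vector_derivative_at_within)
    show "0 < \<rho> - dist x p" using x(2) by simp
    show "F 0 y = f y" if "y \<in> J" "dist y x < \<rho> - dist x p" for y
      by (rule eq) (use that dist_triangle[of y p x] in auto)
  qed
  have f1': "vector_derivative f (at x within J) = F 1 x" if x: "x \<in> J" "dist x p < \<rho>" for x
    using vector_derivative_within[OF _ f1[OF x]] J[OF x(1)] by (simp add: trivial_limit_within)
  show "f differentiable (at p within J)"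
    using f1[OF p] \<rho>(1) differentiableI_vector by simp
  have "((\<lambda>s. vector_derivative f (at s within J)) has_vector_derivative F 2 p) (at p within J)"
  proof (rule has_vector_derivative_transform_within[OF _ \<rho>(1) p])
    show "(F 1 has_vector_derivative F 2 p) (at p within J)"
      using F[of p 1] \<rho>(1) by (simp add: has_vector_derivative_at_within numeral_2_eq_2)
  qed (use f1' in auto)
  then show "(\<lambda>s. vector_derivative f (at s within J)) differentiable (at p within J)"
    by (rule differentiableI_vector)
qed

subsection \<open>Plane Lorentzian forms and brackets\<close>

lemma bracket_eq_cross: "bracket a b c = a \<bullet> cross3 b c"
  by (simp add: bracket_def dot_cross_det)

text \<open>Cramer's rule: the cross products on the right form, up to the factor
  \<open>bracket a b c\<close>, the basis dual to \<open>a\<close>, \<open>b\<close>,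
  \<open>c\<close>. Keeping the factor on the left avoids a division.\<close>

lemma bracket_dual_expansion:
  "bracket a b c *\<^sub>R x = (x \<bullet> a) *\<^sub>R cross3 b c + (x \<bullet> b) *\<^sub>R cross3 c a + (x \<bullet> c) *\<^sub>R cross3 a b"
  by (simp add: bracket_eq_cross cross3_simps forall_3)

lemma vec2_eq: "v = (v$1) *\<^sub>R axis 1 1 + (v$2) *\<^sub>R axis 2 1" for v :: "real^2"
  by (simp add: vec_eq_iff forall_2 axis_def)

text \<open>With a fixed basis, a form that varies with the point is reduced to four scalar
  functions, which is how such forms are differentiated below.\<close>

lemma bilinear_vec2:
  fixes g :: "real^2 \<Rightarrow> real^2 \<Rightarrow> real"
  assumes "bilinear g"
  shows "g v w = (\<Sum>i\<in>UNIV. \<Sum>j\<in>UNIV. v$i * w$j * g (axis i 1) (axis j 1))"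
proof -
  have "g v w = g ((v$1) *\<^sub>R axis 1 1 + (v$2) *\<^sub>R axis 2 1) ((w$1) *\<^sub>R axis 1 1 + (w$2) *\<^sub>R axis 2 1)"
    using vec2_eq[of v] vec2_eq[of w] by simp
  also have "\<dots> = (\<Sum>i\<in>UNIV. \<Sum>j\<in>UNIV. v$i * w$j * g (axis i 1) (axis j 1))"
    using assms by (simp add: bilinear_ladd bilinear_radd bilinear_lmul bilinear_rmul sum_2 algebra_simps)
  finally show ?thesis .
qed

text \<open>Orthogonal vectors of nonzero square are independent, hence span the plane. Pairing with
  them reads off the coefficients, and the minus sign comes from the negative square of
  \<open>e\<^sub>2\<close>.\<close>

lemma lorentzian_expansion:
  assumes g: "lorentzian g" and e: "g e\<^sub>1 e\<^sub>1 = 1" "g e\<^sub>2 e\<^sub>2 = -1" "g e\<^sub>1 e\<^sub>2 = 0"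
  shows "w = g w e\<^sub>1 *\<^sub>R e\<^sub>1 - g w e\<^sub>2 *\<^sub>R e\<^sub>2"
proof -
  have bl: "bilinear g" and sym: "\<And>v w. g v w = g w v"
    using g unfolding lorentzian_def by blast+
  have e21: "g e\<^sub>2 e\<^sub>1 = 0" using e(3) sym by simp
  have ne: "e\<^sub>1 \<noteq> e\<^sub>2" using e(1,3) by auto
  have "independent {e\<^sub>1, e\<^sub>2}"
  proof (rule independent_insertI)
    show "e\<^sub>1 \<notin> span {e\<^sub>2}"
    proof
      assume "e\<^sub>1 \<in> span {e\<^sub>2}"
      then obtain k where "e\<^sub>1 = k *\<^sub>R e\<^sub>2" by (auto simp: span_singleton)
      moreover have "g e\<^sub>1 (k *\<^sub>R e\<^sub>2) = 0" using e(3) by (simp add: bilinear_rmul[OF bl])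
      ultimately show False using e(1) by simp
    qed
    have "e\<^sub>2 \<noteq> 0" using e(2) bilinear_rzero[OF bl] by fastforce
    then show "independent {e\<^sub>2}" by simp
  qed
  then have "UNIV \<subseteq> span {e\<^sub>1, e\<^sub>2}"
    by (rule card_ge_dim_independent[rotated]) (use ne in auto)
  then obtain k where "w - k *\<^sub>R e\<^sub>1 \<in> span {e\<^sub>2}"
    using span_breakdown_eq[of w e\<^sub>1 "{e\<^sub>2}"] by auto
  then obtain l where "w - k *\<^sub>R e\<^sub>1 = l *\<^sub>R e\<^sub>2" by (auto simp: span_singleton)
  then have w: "w = k *\<^sub>R e\<^sub>1 + l *\<^sub>R e\<^sub>2" by (simp add: algebra_simps)
  have "g w e\<^sub>1 = k" "g w e\<^sub>2 = - l"
    unfolding w using e e21 by (simp_all add: bilinear_ladd[OF bl] bilinear_lmul[OF bl])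
  with w show ?thesis by simp
qed

lemma lorentzian_gram_bracket:
  assumes g: "lorentzian g"
    and gram: "\<And>v w. sqrt ((g v w)\<^sup>2 - g v v * g w w) = \<bar>bracket (L v) (L w) \<xi>\<bar>"
  shows "(g v w)\<^sup>2 - g v v * g w w = (bracket (L v) (L w) \<xi>)\<^sup>2"
    and "\<exists>v w. bracket (L v) (L w) \<xi> \<noteq> 0"
proof -
  \<comment> \<open>In Isabelle \<open>sqrt\<close> is negative on negative numbers. Being equal to
    an absolute value, the root is nonnegative, so the radicand is too and squaring is
    legitimate.\<close>
  have "0 \<le> sqrt ((g v w)\<^sup>2 - g v v * g w w)" by (simp only: gram abs_ge_zero)
  then have "(g v w)\<^sup>2 - g v v * g w w = (sqrt ((g v w)\<^sup>2 - g v v * g w w))\<^sup>2"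
    by simp
  then show "(g v w)\<^sup>2 - g v v * g w w = (bracket (L v) (L w) \<xi>)\<^sup>2" by (simp only: gram power2_abs)
  obtain e\<^sub>1 e\<^sub>2 where "g e\<^sub>1 e\<^sub>1 = 1" "g e\<^sub>2 e\<^sub>2 = -1" "g e\<^sub>1 e\<^sub>2 = 0"
    using g unfolding lorentzian_def by blast
  then have "\<bar>bracket (L e\<^sub>1) (L e\<^sub>2) \<xi>\<bar> = 1" using gram[of e\<^sub>1 e\<^sub>2] by simp
  then have "bracket (L e\<^sub>1) (L e\<^sub>2) \<xi> \<noteq> 0" by auto
  then show "\<exists>v w. bracket (L v) (L w) \<xi> \<noteq> 0" by blast
qed

text \<open>The left side is alternating and bilinear in \<open>v\<close> and \<open>w\<close>,
  hence a multiple of the determinant of the plane.\<close>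

lemma bracket_linear_image:
  fixes L :: "real^2 \<Rightarrow> real^3"
  assumes "linear L"
  shows "bracket (L v) (L w) \<xi> = (v$1 * w$2 - v$2 * w$1) * bracket (L (axis 1 1)) (L (axis 2 1)) \<xi>"
proof -
  have "L v = (v$1) *\<^sub>R L (axis 1 1) + (v$2) *\<^sub>R L (axis 2 1)" for v
    using arg_cong[OF vec2_eq[of v], of L] by (simp add: linear_add[OF assms] linear_cmul[OF assms])
  note this[of v] this[of w]
  then show ?thesis by (simp only: bracket_eq_cross) (simp add: cross3_simps)
qed

lemma parallel_vec2_iff:
  fixes v a :: "real^2"
  assumes "v \<noteq> 0"
  shows "(\<exists>\<mu>. a = \<mu> *\<^sub>R v) \<longleftrightarrow> v$1 * a$2 - v$2 * a$1 = 0"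
proof
  assume *: "v$1 * a$2 - v$2 * a$1 = 0"
  from assms consider "v$1 \<noteq> 0" | "v$2 \<noteq> 0" by (auto simp: vec_eq_iff forall_2)
  then show "\<exists>\<mu>. a = \<mu> *\<^sub>R v"
  proof cases
    case 1
    then have "a = (a$1 / v$1) *\<^sub>R v" using * by (simp add: vec_eq_iff forall_2 field_simps)
    then show ?thesis ..
  next
    case 2
    then have "a = (a$2 / v$2) *\<^sub>R v" using * by (simp add: vec_eq_iff forall_2 field_simps)
    then show ?thesis ..
  qed
qed auto

text \<open>The algebra at a single point, with \<open>U1\<close> and \<open>U2\<close> in the roles
  of U' and U''. Since \<open>U\<close> is a multiple of the cross product of two tangent vectors,
  the bracket of \<open>U\<close>, \<open>U1\<close>, \<open>U2\<close> is determined by the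
  pairings of \<open>U1\<close> and \<open>U2\<close> with tangent vectors.\<close>

lemma bracket_eq_iff_parallel:
  fixes L :: "real^2 \<Rightarrow> real^3"
  assumes L: "linear L" and g: "lorentzian g"
    and gram: "\<And>v w. sqrt ((g v w)\<^sup>2 - g v v * g w w) = \<bar>bracket (L v) (L w) \<xi>\<bar>"
    and U: "U \<bullet> \<xi> = 1" "\<And>w. U \<bullet> L w = 0"
    and U1: "\<And>w. U1 \<bullet> L w = - g v w"
    and U2: "\<And>w. U2 \<bullet> L w = g b w - 2 * g a w"
    and v: "v \<noteq> 0"
  shows "bracket (L v) (L b + k *\<^sub>R \<xi>) \<xi> = bracket U U1 U2 \<longleftrightarrow> (\<exists>\<mu>. a = \<mu> *\<^sub>R v)"
proof -
  define e1 e2 :: "real^2" where "e1 = axis 1 1" and "e2 = axis 2 1"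
  define \<omega> where "\<omega> = bracket (L e1) (L e2) \<xi>"
  have bl: "bilinear g" and sym: "\<And>v w. g v w = g w v"
    using g unfolding lorentzian_def by blast+
  have image: "bracket (L x) (L y) \<xi> = (x$1 * y$2 - x$2 * y$1) * \<omega>" for x y
    unfolding \<omega>_def e1_def e2_def by (rule bracket_linear_image[OF L])
  have \<omega>: "\<omega> \<noteq> 0"
    using lorentzian_gram_bracket(2)[OF g gram] image by auto
  have g_e: "g x e1 = x$1 * g e1 e1 + x$2 * g e1 e2" "g x e2 = x$1 * g e1 e2 + x$2 * g e2 e2" for x
    using bilinear_vec2[OF bl, of x e1] bilinear_vec2[OF bl, of x e2] sym[of "axis 2 1" "axis 1 1"]
    by (simp_all add: e1_def e2_def sum_2 axis_def)
  \<comment> \<open>As \<open>U\<close> is orthogonal to the tangent plane, only the term carrying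
    \<xi> survives in the dual expansion.\<close>
  have "\<omega> *\<^sub>R U = cross3 (L e1) (L e2)"
    using bracket_dual_expansion[of "L e1" "L e2" \<xi> U] U by (simp add: \<omega>_def)
  then have "\<omega> * bracket U U1 U2 = cross3 (L e1) (L e2) \<bullet> cross3 U1 U2"
    by (metis bracket_eq_cross inner_scaleR_left)
  also have "\<dots> = (U1 \<bullet> L e1) * (U2 \<bullet> L e2) - (U1 \<bullet> L e2) * (U2 \<bullet> L e1)"
    by (subst inner_commute) (rule dot_cross)
  \<comment> \<open>The matrix of pairings is the coordinate matrix of \<open>- v\<close> and
    \<open>b - 2 *\<^sub>R a\<close> times the Gram matrix of \<open>g\<close>, so determinants
    multiply. The sign of \<open>- v\<close> is absorbed by writing minus the Gram determinant,
    which is the square of \<omega>.\<close>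
  also have "\<dots> = (v$1 * (b - 2 *\<^sub>R a)$2 - v$2 * (b - 2 *\<^sub>R a)$1) * ((g e1 e2)\<^sup>2 - g e1 e1 * g e2 e2)"
    unfolding U1 U2 g_e[of a] g_e[of b] g_e[of v] by (simp add: algebra_simps power2_eq_square)
  also have "(g e1 e2)\<^sup>2 - g e1 e1 * g e2 e2 = \<omega>\<^sup>2"
    unfolding \<omega>_def by (rule lorentzian_gram_bracket(1)[OF g gram])
  finally have "bracket U U1 U2 = (v$1 * (b - 2 *\<^sub>R a)$2 - v$2 * (b - 2 *\<^sub>R a)$1) * \<omega>"
    using \<omega> by (simp add: power2_eq_square)
  moreover have "bracket (L v) (L b + k *\<^sub>R \<xi>) \<xi> = bracket (L v) (L b) \<xi>"
    by (simp add: bracket_eq_cross cross_add_left cross_mult_left)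
  moreover have "\<dots> = (v$1 * b$2 - v$2 * b$1) * \<omega>"
    by (rule image)
  ultimately have "bracket (L v) (L b + k *\<^sub>R \<xi>) \<xi> - bracket U U1 U2
      = 2 * \<omega> * (v$1 * a$2 - v$2 * a$1)"
    by (simp add: algebra_simps)
  then show ?thesis
    unfolding parallel_vec2_iff[OF v] using \<omega> by auto
qed

subsection \<open>The Levi-Civita connection\<close>

lemma smooth_on_const: "smooth_on (\<lambda>_. c) S"
proof -
  have "Ck_on n (\<lambda>_. c) S" for n by (induction n arbitrary: c) auto
  then show ?thesis by (simp add: smooth_on_def)
qed

lemma smooth_on_differentiable: "smooth_on f S \<Longrightarrow> x \<in> S \<Longrightarrow> f differentiable (at x)"
  unfolding smooth_on_def by (metis Ck_on.simps(2))

lemma smooth_on_has_derivative: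
  "smooth_on f S \<Longrightarrow> x \<in> S \<Longrightarrow> (f has_derivative frechet_derivative f (at x)) (at x)"
  using smooth_on_differentiable frechet_derivative_works by blast

lemma smooth_on_frechet_derivative:
  "smooth_on f S \<Longrightarrow> smooth_on (\<lambda>x. frechet_derivative f (at x) v) S"
  unfolding smooth_on_def by (metis Ck_on.simps(2))

lemma smooth_on_continuous: "smooth_on f S \<Longrightarrow> continuous_on S f"
  unfolding smooth_on_def by (metis Ck_on.simps(1))

text \<open>\<open>frechet_derivative\<close> is a choice from the predicate
  \<open>has_derivative\<close>, and this predicate is the same for two maps that agree near
  \<open>x\<close>. Equality thus follows without a separate case for maps that are not
  differentiable.\<close>

lemma frechet_derivative_cong_open:
  assumes "open S" "x \<in> S" "\<And>y. y \<in> S \<Longrightarrow> f y = g y"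
  shows "frechet_derivative f (at x) = frechet_derivative g (at x)"
proof -
  have "(f has_derivative f') (at x) \<longleftrightarrow> (g has_derivative f') (at x)" for f'
    using assms has_derivative_transform_within_open[of f f' x UNIV S g]
      has_derivative_transform_within_open[of g f' x UNIV S f] by auto
  then show ?thesis by (simp add: frechet_derivative_def)
qed

text \<open>Pairing with an arbitrary fixed vector \<open>m\<close> commutes with differentiation
  and reduces the claim to real-valued maps.\<close>

lemma frechet_derivative_symmetric:
  fixes f :: "'a::euclidean_space \<Rightarrow> 'b::real_inner"
  assumes S: "open S" "x \<in> S" and f: "smooth_on f S"
  shows "frechet_derivative (\<lambda>z. frechet_derivative f (at z) v) (at x) w
       = frechet_derivative (\<lambda>z. frechet_derivative f (at z) w) (at x) v"
proof (rule vector_eq_ldot[THEN iffD1])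
  have inner: "frechet_derivative (\<lambda>z. F z \<bullet> m) (at y) u = frechet_derivative F (at y) u \<bullet> m"
    "(\<lambda>z. F z \<bullet> m) differentiable (at y)"
    if "smooth_on F S" "y \<in> S" for F :: "'a \<Rightarrow> 'b" and m y u
  proof -
    have *: "((\<lambda>z. F z \<bullet> m) has_derivative (\<lambda>u. frechet_derivative F (at y) u \<bullet> m)) (at y)"
      using smooth_on_has_derivative[OF that] by (auto intro!: derivative_eq_intros)
    show "frechet_derivative (\<lambda>z. F z \<bullet> m) (at y) u = frechet_derivative F (at y) u \<bullet> m"
      using frechet_derivative_at[OF *] by metis
    show "(\<lambda>z. F z \<bullet> m) differentiable (at y)" using * by (auto simp: differentiable_def)
  qed
  note f1 = smooth_on_frechet_derivative[OF f]
  note f2 = smooth_on_frechet_derivative[OF f1]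
  have second: "frechet_derivative (\<lambda>z. frechet_derivative (\<lambda>z. f z \<bullet> m) (at z) u) (at y) u'
      = frechet_derivative (\<lambda>z. frechet_derivative f (at z) u) (at y) u' \<bullet> m"
    if "y \<in> S" for y u u' m
    using frechet_derivative_cong_open[OF S(1) that, of
        "\<lambda>z. frechet_derivative (\<lambda>z. f z \<bullet> m) (at z) u" "\<lambda>z. frechet_derivative f (at z) u \<bullet> m"]
      inner(1)[OF f] inner(1)[OF f1 that] by metis
  show "\<forall>m. m \<bullet> frechet_derivative (\<lambda>z. frechet_derivative f (at z) v) (at x) w
      = m \<bullet> frechet_derivative (\<lambda>z. frechet_derivative f (at z) w) (at x) v"
  proof
    fix m
    have "frechet_derivative (\<lambda>z. frechet_derivative (\<lambda>z. f z \<bullet> m) (at z) v) (at x) w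
        = frechet_derivative (\<lambda>z. frechet_derivative (\<lambda>z. f z \<bullet> m) (at z) w) (at x) v"
    proof (rule frechet_derivative_symmetric_real[OF S])
      fix y u u' assume y: "y \<in> S"
      show "(\<lambda>z. f z \<bullet> m) differentiable (at y)" by (rule inner(2)[OF f y])
      have "(\<lambda>z. frechet_derivative f (at z) u \<bullet> m) differentiable (at y)"
        by (rule inner(2)[OF f1 y])
      then obtain D where "((\<lambda>z. frechet_derivative f (at z) u \<bullet> m) has_derivative D) (at y)"
        by (auto simp: differentiable_def)
      then have "((\<lambda>z. frechet_derivative (\<lambda>z. f z \<bullet> m) (at z) u) has_derivative D) (at y)"
        by (rule has_derivative_transform_within_open[OF _ S(1) y]) (simp add: inner(1)[OF f])
      then show "(\<lambda>z. frechet_derivative (\<lambda>z. f z \<bullet> m) (at z) u) differentiable (at y)"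
        by (auto simp: differentiable_def)
    next
      fix u u'
      have "continuous_on S (\<lambda>y. frechet_derivative (\<lambda>z. frechet_derivative f (at z) u) (at y) u' \<bullet> m)"
        by (intro continuous_intros smooth_on_continuous f2)
      then show "continuous_on S (\<lambda>y. frechet_derivative
          (\<lambda>z. frechet_derivative (\<lambda>z. f z \<bullet> m) (at z) u) (at y) u')"
        by (subst continuous_on_cong[OF refl second]) auto
    qed
    then show "m \<bullet> frechet_derivative (\<lambda>z. frechet_derivative f (at z) v) (at x) w
      = m \<bullet> frechet_derivative (\<lambda>z. frechet_derivative f (at z) w) (at x) v"
      using second[OF S(2)] by (simp add: inner_commute)
  qed
qed

section \<open>Differentiation of a field of bilinear forms\<close>

lemma frechet_derivative_metric:
  fixes g :: "real^2 \<Rightarrow> real^2 \<Rightarrow> real^2 \<Rightarrow> real"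
  assumes S: "open S" "x \<in> S" and bl: "\<And>y. y \<in> S \<Longrightarrow> bilinear (g y)"
    and g: "\<And>v w. (\<lambda>y. g y v w) differentiable (at x)"
  shows "frechet_derivative (\<lambda>y. g y v w) (at x) u
    = (\<Sum>i\<in>UNIV. \<Sum>j\<in>UNIV. v$i * w$j *
        frechet_derivative (\<lambda>y. g y (axis i 1) (axis j 1)) (at x) u)"
proof -
  let ?s = "\<lambda>y. \<Sum>i\<in>UNIV. \<Sum>j\<in>UNIV. v$i * w$j * g y (axis i 1) (axis j 1)"
  have "((\<lambda>y. g y a b) has_derivative frechet_derivative (\<lambda>y. g y a b) (at x)) (at x)" for a b
    using g frechet_derivative_works by blast
  then have "(?s has_derivative (\<lambda>u. \<Sum>i\<in>UNIV. \<Sum>j\<in>UNIV. v$i * w$j *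
        frechet_derivative (\<lambda>y. g y (axis i 1) (axis j 1)) (at x) u)) (at x)"
    by (intro has_derivative_sum has_derivative_mult_right)
  note D = frechet_derivative_at[OF this, symmetric]
  have "frechet_derivative (\<lambda>y. g y v w) (at x) = frechet_derivative ?s (at x)"
    by (rule frechet_derivative_cong_open[OF S]) (rule bilinear_vec2[OF bl])
  then show ?thesis unfolding D by simp
qed

text \<open>The product rule in components, with one term for each of the two vectors and one for
  the base point. The general map \<phi> covers both vector fields on \<open>S\<close>, where it is
  the identity, and vector fields along a curve defined on an interval or part of one.\<close>

lemma has_derivative_metric:
  fixes g :: "real^2 \<Rightarrow> real^2 \<Rightarrow> real^2 \<Rightarrow> real" and \<phi> :: "'a::real_normed_vector \<Rightarrow> real^2"
  assumes S: "open S" and bl: "\<And>y. y \<in> S \<Longrightarrow> bilinear (g y)"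
    and g: "\<And>y v w. y \<in> S \<Longrightarrow> (\<lambda>y. g y v w) differentiable (at y)"
    and \<phi>: "\<And>t. t \<in> T \<Longrightarrow> \<phi> t \<in> S" and s: "s \<in> T"
    and \<phi>': "(\<phi> has_derivative \<phi>') (at s within T)"
    and Y: "(Y has_derivative Y') (at s within T)" and Z: "(Z has_derivative Z') (at s within T)"
  shows "((\<lambda>t. g (\<phi> t) (Y t) (Z t)) has_derivative
    (\<lambda>u. g (\<phi> s) (Y' u) (Z s) + g (\<phi> s) (Y s) (Z' u)
      + frechet_derivative (\<lambda>y. g y (Y s) (Z s)) (at (\<phi> s)) (\<phi>' u))) (at s within T)"
proof -
  have G: "((\<lambda>t. g (\<phi> t) a b) has_derivative
      (\<lambda>u. frechet_derivative (\<lambda>y. g y a b) (at (\<phi> s)) (\<phi>' u))) (at s within T)" for a b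
    using g[OF \<phi>[OF s]] frechet_derivative_works by (intro has_derivative_compose[OF \<phi>']) blast
  have comp: "((\<lambda>t. f t $ i) has_derivative (\<lambda>u. f' u $ i)) (at s within T)"
    if "(f has_derivative f') (at s within T)" for f f' and i :: 2
    by (rule bounded_linear.has_derivative[OF bounded_linear_vec_nth that])
  have "((\<lambda>t. \<Sum>i\<in>UNIV. \<Sum>j\<in>UNIV. Y t $ i * Z t $ j * g (\<phi> t) (axis i 1) (axis j 1)) has_derivative
      (\<lambda>u. \<Sum>i\<in>UNIV. \<Sum>j\<in>UNIV. Y s $ i * Z s $ j *
          frechet_derivative (\<lambda>y. g y (axis i 1) (axis j 1)) (at (\<phi> s)) (\<phi>' u)
        + (Y s $ i * Z' u $ j + Y' u $ i * Z s $ j) * g (\<phi> s) (axis i 1) (axis j 1))) (at s within T)"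
    by (intro has_derivative_sum has_derivative_mult comp Y Z G)
  also have "(\<lambda>u. \<Sum>i\<in>UNIV. \<Sum>j\<in>UNIV. Y s $ i * Z s $ j *
          frechet_derivative (\<lambda>y. g y (axis i 1) (axis j 1)) (at (\<phi> s)) (\<phi>' u)
        + (Y s $ i * Z' u $ j + Y' u $ i * Z s $ j) * g (\<phi> s) (axis i 1) (axis j 1))
      = (\<lambda>u. g (\<phi> s) (Y' u) (Z s) + g (\<phi> s) (Y s) (Z' u)
        + frechet_derivative (\<lambda>y. g y (Y s) (Z s)) (at (\<phi> s)) (\<phi>' u))"
    using bilinear_vec2[OF bl[OF \<phi>[OF s]], of "Y' _" "Z s"]
      bilinear_vec2[OF bl[OF \<phi>[OF s]], of "Y s" "Z' _"]
      frechet_derivative_metric[OF S \<phi>[OF s] bl g[OF \<phi>[OF s]], of "Y s" "Z s" "\<phi>' _"]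
    by (intro ext) (simp only:, simp add: sum.distrib distrib_left distrib_right)
  finally show ?thesis
    by (rule has_derivative_transform_within[OF _ zero_less_one s])
      (simp add: bilinear_vec2[OF bl[OF \<phi>], symmetric])
qed

text \<open>The Koszul formula prescribes the pairing of \<open>G x u v\<close> with each
  \<open>w\<close>; nondegeneracy of \<open>g x\<close> then yields the vector itself.\<close>

lemma levi_civita_exists:
  assumes S: "open S" and lor: "\<And>x. x \<in> S \<Longrightarrow> lorentzian (g x)"
    and g: "\<And>x v w. x \<in> S \<Longrightarrow> (\<lambda>y. g y v w) differentiable (at x)"
  shows "\<exists>G. levi_civita S g G"
proof -
  have bl: "bilinear (g x)" and sym: "g x v w = g x w v" if "x \<in> S" for x v w
    using lor[OF that] unfolding lorentzian_def by blast+
  define D where "D x u v w = frechet_derivative (\<lambda>y. g y v w) (at x) u" for x u v w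
  have D_eq: "D x u v w = (\<Sum>i\<in>UNIV. \<Sum>j\<in>UNIV. v$i * w$j * D x u (axis i 1) (axis j 1))"
    if "x \<in> S" for x u v w
    unfolding D_def using frechet_derivative_metric[OF S that bl g[OF that]] by blast
  have D_sym: "D x u v w = D x u w v" if "x \<in> S" for x u v w
    unfolding D_def by (rule fun_cong[OF frechet_derivative_cong_open[OF S that sym]])
  have lin1: "linear (\<lambda>u. D x u v w)" if "x \<in> S" for x v w
    unfolding D_def using g[OF that] by (rule linear_frechet_derivative)
  have lin3: "linear (\<lambda>w. D x u v w)" if "x \<in> S" for x u v
  proof (rule linearI)
    show "D x u v (a + b) = D x u v a + D x u v b" for a b
      using D_eq[OF that, of u v a] D_eq[OF that, of u v b] D_eq[OF that, of u v "a + b"]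
      by (simp add: sum_2 algebra_simps)
    show "D x u v (k *\<^sub>R a) = k *\<^sub>R D x u v a" for k a
      using D_eq[OF that, of u v a] D_eq[OF that, of u v "k *\<^sub>R a"]
      by (simp add: sum_2 algebra_simps)
  qed
  have lin2: "linear (\<lambda>v. D x u v w)" if "x \<in> S" for x u w
    using lin3[OF that, of u w] D_sym[OF that] by simp
  \<comment> \<open>The Koszul formula for constant fields, whose Lie brackets vanish; these are the
    Christoffel symbols of the first kind.\<close>
  define K where "K x u v w = (D x u v w + D x v u w - D x w u v) / 2" for x u v w
  have K1: "linear (\<lambda>u. K x u v w)" and K2: "linear (\<lambda>v. K x u v w)" and K3: "linear (\<lambda>w. K x u v w)"
    if "x \<in> S" for x u v w
    unfolding K_def
    by (auto intro!: linearI simp: linear_add[OF lin1[OF that]] linear_add[OF lin2[OF that]]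
        linear_add[OF lin3[OF that]] linear_cmul[OF lin1[OF that]] linear_cmul[OF lin2[OF that]]
        linear_cmul[OF lin3[OF that]] field_simps)
  have K_sym: "K x u v w = K x v u w" if "x \<in> S" for x u v w
    unfolding K_def using D_sym[OF that, of w u v] by simp
  have K_metric: "K x u v w + K x u w v = D x u v w" if "x \<in> S" for x u v w
    unfolding K_def using D_sym[OF that, of u v w] D_sym[OF that, of v u w] D_sym[OF that, of w u v]
    by (simp add: field_simps)
  have "\<exists>e. g x (fst e) (fst e) = 1 \<and> g x (snd e) (snd e) = -1 \<and> g x (fst e) (snd e) = 0"
    if "x \<in> S" for x
    using lor[OF that] unfolding lorentzian_def by simp
  then have "\<forall>x\<in>S. \<exists>e. g x (fst e) (fst e) = 1 \<and> g x (snd e) (snd e) = -1 \<and> g x (fst e) (snd e) = 0"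
    by blast
  from bchoice[OF this] obtain e where e: "\<And>x. x \<in> S \<Longrightarrow> g x (fst (e x)) (fst (e x)) = 1"
    "\<And>x. x \<in> S \<Longrightarrow> g x (snd (e x)) (snd (e x)) = -1" "\<And>x. x \<in> S \<Longrightarrow> g x (fst (e x)) (snd (e x)) = 0"
    by blast
  \<comment> \<open>The index of \<open>K\<close> is raised with an orthonormal frame. The frame can
    be chosen at each point separately, because \<open>gG\<close> characterises \<open>G\<close> by
    \<open>g\<close> and \<open>K\<close> alone.\<close>
  define G where "G x u v = K x u v (fst (e x)) *\<^sub>R fst (e x) - K x u v (snd (e x)) *\<^sub>R snd (e x)" for x u v
  have gG: "g x (G x u v) w = K x u v w" if x: "x \<in> S" for x u v w
  proof -
    define c1 c2 where "c1 = g x w (fst (e x))" and "c2 = g x w (snd (e x))"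
    have w: "w = c1 *\<^sub>R fst (e x) - c2 *\<^sub>R snd (e x)"
      unfolding c1_def c2_def by (rule lorentzian_expansion[OF lor[OF x] e[OF x]])
    have "g x (G x u v) w = K x u v (fst (e x)) * c1 - K x u v (snd (e x)) * c2"
      unfolding G_def c1_def c2_def using sym[OF x, of w]
      by (simp add: bilinear_lsub[OF bl[OF x]] bilinear_lmul[OF bl[OF x]])
    also have "\<dots> = K x u v w"
      by (subst w) (simp add: linear_diff[OF K3[OF x]] linear_cmul[OF K3[OF x]])
    finally show ?thesis .
  qed
  have "bilinear (G x)" if x: "x \<in> S" for x
    unfolding bilinear_def G_def
    by (auto intro!: linearI simp: linear_add[OF K1[OF x]] linear_add[OF K2[OF x]]
        linear_cmul[OF K1[OF x]] linear_cmul[OF K2[OF x]] algebra_simps)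
  moreover have "connection G X Y x - connection G Y X x
      = frechet_derivative Y (at x) (X x) - frechet_derivative X (at x) (Y x)" if "x \<in> S" for X Y x
    unfolding connection_def G_def using K_sym[OF that, of "X x" "Y x"] by simp
  moreover have "frechet_derivative (\<lambda>y. g y (Y y) (Z y)) (at x) (X x)
      = g x (connection G X Y x) (Z x) + g x (Y x) (connection G X Z x)"
    if "smooth_on Y S" "smooth_on Z S" and x: "x \<in> S" for X Y Z x
  proof -
    have "((\<lambda>y. g y (Y y) (Z y)) has_derivative
      (\<lambda>u. g x (frechet_derivative Y (at x) u) (Z x) + g x (Y x) (frechet_derivative Z (at x) u)
        + frechet_derivative (\<lambda>y. g y (Y x) (Z x)) (at x) u)) (at x)"
      using has_derivative_metric[OF S bl g, where T = S and \<phi> = "\<lambda>y. y" and s = x,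
          OF _ _ _ x has_derivative_ident, of Y _ Z]
        smooth_on_has_derivative[OF that(1) x] smooth_on_has_derivative[OF that(2) x]
      by (simp add: at_within_open[OF x S])
    from fun_cong[OF frechet_derivative_at[OF this], of "X x"]
    have "frechet_derivative (\<lambda>y. g y (Y y) (Z y)) (at x) (X x)
      = g x (frechet_derivative Y (at x) (X x)) (Z x) + g x (Y x) (frechet_derivative Z (at x) (X x))
        + D x (X x) (Y x) (Z x)"
      unfolding D_def by simp
    then show ?thesis
      unfolding connection_def bilinear_ladd[OF bl[OF x]] bilinear_radd[OF bl[OF x]] gG[OF x]
        sym[OF x, of "Y x" "G x (X x) (Z x)"]
      using K_metric[OF x, of "X x" "Y x" "Z x"] by simp
  qed
  ultimately show ?thesis unfolding levi_civita_def by blast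
qed

text \<open>Constant fields have vanishing coordinate derivative, so the axioms of the connection
  reduce to identities for its Christoffel symbols.\<close>

lemma levi_civita_constant_fields:
  assumes "levi_civita S g G" "x \<in> S"
  shows "frechet_derivative (\<lambda>y. g y v w) (at x) u = g x (G x u v) w + g x v (G x u w)"
    and "G x u v = G x v u"
proof -
  note const = smooth_on_const[of _ S]
  have "frechet_derivative (\<lambda>y. g y v w) (at x) u
      = g x (connection G (\<lambda>_. u) (\<lambda>_. v) x) w + g x v (connection G (\<lambda>_. u) (\<lambda>_. w) x)"
    using assms const unfolding levi_civita_def by blast
  then show "frechet_derivative (\<lambda>y. g y v w) (at x) u = g x (G x u v) w + g x v (G x u w)"
    by (simp add: connection_def)
  have "connection G (\<lambda>_. u) (\<lambda>_. v) x - connection G (\<lambda>_. v) (\<lambda>_. u) x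
      = frechet_derivative (\<lambda>_. v) (at x) u - frechet_derivative (\<lambda>_. u) (at x) v"
    using assms const unfolding levi_civita_def by blast
  then show "G x u v = G x v u"
    by (simp add: connection_def)
qed

subsection \<open>Curves in a chart\<close>

lemma has_vector_derivative_compose_at:
  assumes "(\<phi> has_vector_derivative \<phi>') (at s within T)" "f differentiable (at (\<phi> s))"
  shows "((\<lambda>t. f (\<phi> t)) has_vector_derivative frechet_derivative f (at (\<phi> s)) \<phi>') (at s within T)"
proof -
  have F: "(f has_derivative frechet_derivative f (at (\<phi> s))) (at (\<phi> s))"
    using assms(2) frechet_derivative_works by blast
  show ?thesis
    using has_derivative_compose[OF assms(1)[unfolded has_vector_derivative_def] F]
    unfolding has_vector_derivative_def linear_cmul[OF has_derivative_linear[OF F]] .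
qed

text \<open>Product rule for a differential applied to a moving vector. One term moves the vector;
  the other moves the base point with the vector frozen at \<open>V s\<close>. Expansion in the
  fixed basis reduces it to scalar multiples of maps composed with \<phi>.\<close>

lemma has_vector_derivative_frechet_along:
  fixes f :: "real^2 \<Rightarrow> 'b::real_normed_vector"
  assumes S: "open S" and f: "smooth_on f S" and \<phi>: "\<And>t. t \<in> T \<Longrightarrow> \<phi> t \<in> S" and s: "s \<in> T"
    and \<phi>': "(\<phi> has_vector_derivative \<phi>') (at s within T)"
    and V: "(V has_vector_derivative V') (at s within T)"
  shows "((\<lambda>t. frechet_derivative f (at (\<phi> t)) (V t)) has_vector_derivative
    frechet_derivative f (at (\<phi> s)) V'
      + frechet_derivative (\<lambda>y. frechet_derivative f (at y) (V s)) (at (\<phi> s)) \<phi>') (at s within T)"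
proof -
  note f1 = smooth_on_frechet_derivative[OF f]
  have expand: "frechet_derivative f (at y) v
      = (v$1) *\<^sub>R frechet_derivative f (at y) (axis 1 1) + (v$2) *\<^sub>R frechet_derivative f (at y) (axis 2 1)"
    if "y \<in> S" for y v
  proof -
    have "linear (frechet_derivative f (at y))"
      using smooth_on_differentiable[OF f that] by (rule linear_frechet_derivative)
    note lin = linear_add[OF this] linear_cmul[OF this]
    show ?thesis using arg_cong[OF vec2_eq[of v], of "frechet_derivative f (at y)"]
      by (simp only: lin)
  qed
  have D: "((\<lambda>t. frechet_derivative f (at (\<phi> t)) u) has_vector_derivative
      frechet_derivative (\<lambda>y. frechet_derivative f (at y) u) (at (\<phi> s)) \<phi>') (at s within T)" for u
    by (rule has_vector_derivative_compose_at[OF \<phi>' smooth_on_differentiable[OF f1 \<phi>[OF s]]])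
  have comp: "((\<lambda>t. V t $ i) has_real_derivative V' $ i) (at s within T)" for i
    unfolding has_real_derivative_iff_has_vector_derivative
    by (rule bounded_linear.has_vector_derivative[OF bounded_linear_vec_nth V])
  \<comment> \<open>The second derivative is also linear in the vector differentiated along first.
    The basis expansion holds only on \<open>S\<close>, hence the passage through local
    congruence.\<close>
  have F2: "frechet_derivative (\<lambda>y. frechet_derivative f (at y) v) (at (\<phi> s)) u
      = (v$1) *\<^sub>R frechet_derivative (\<lambda>y. frechet_derivative f (at y) (axis 1 1)) (at (\<phi> s)) u
      + (v$2) *\<^sub>R frechet_derivative (\<lambda>y. frechet_derivative f (at y) (axis 2 1)) (at (\<phi> s)) u" for u v
  proof -
    let ?e = "\<lambda>y. (v$1) *\<^sub>R frechet_derivative f (at y) (axis 1 1) + (v$2) *\<^sub>R frechet_derivative f (at y) (axis 2 1)"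
    have cong: "frechet_derivative (\<lambda>y. frechet_derivative f (at y) v) (at (\<phi> s))
        = frechet_derivative ?e (at (\<phi> s))"
      by (rule frechet_derivative_cong_open[OF S \<phi>[OF s] expand])
    have "(?e has_derivative (\<lambda>u.
        (v$1) *\<^sub>R frechet_derivative (\<lambda>y. frechet_derivative f (at y) (axis 1 1)) (at (\<phi> s)) u
      + (v$2) *\<^sub>R frechet_derivative (\<lambda>y. frechet_derivative f (at y) (axis 2 1)) (at (\<phi> s)) u)) (at (\<phi> s))"
      by (intro has_derivative_add has_derivative_scaleR_right smooth_on_has_derivative[OF f1] \<phi> s)
    from fun_cong[OF frechet_derivative_at[OF this], of u] show ?thesis unfolding cong by simp
  qed
  have "((\<lambda>t. (V t $ 1) *\<^sub>R frechet_derivative f (at (\<phi> t)) (axis 1 1)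
        + (V t $ 2) *\<^sub>R frechet_derivative f (at (\<phi> t)) (axis 2 1)) has_vector_derivative
      ((V s $ 1) *\<^sub>R frechet_derivative (\<lambda>y. frechet_derivative f (at y) (axis 1 1)) (at (\<phi> s)) \<phi>'
          + (V' $ 1) *\<^sub>R frechet_derivative f (at (\<phi> s)) (axis 1 1))
        + ((V s $ 2) *\<^sub>R frechet_derivative (\<lambda>y. frechet_derivative f (at y) (axis 2 1)) (at (\<phi> s)) \<phi>'
          + (V' $ 2) *\<^sub>R frechet_derivative f (at (\<phi> s)) (axis 2 1))) (at s within T)"
    by (intro has_vector_derivative_add has_vector_derivative_scaleR comp D)
  then have "((\<lambda>t. frechet_derivative f (at (\<phi> t)) (V t)) has_vector_derivative
      ((V s $ 1) *\<^sub>R frechet_derivative (\<lambda>y. frechet_derivative f (at y) (axis 1 1)) (at (\<phi> s)) \<phi>'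
          + (V' $ 1) *\<^sub>R frechet_derivative f (at (\<phi> s)) (axis 1 1))
        + ((V s $ 2) *\<^sub>R frechet_derivative (\<lambda>y. frechet_derivative f (at y) (axis 2 1)) (at (\<phi> s)) \<phi>'
          + (V' $ 2) *\<^sub>R frechet_derivative f (at (\<phi> s)) (axis 2 1))) (at s within T)"
    by (rule has_vector_derivative_transform[OF s, rotated]) (rule expand[OF \<phi>])
  then show ?thesis
    unfolding F2[of "V s"] expand[OF \<phi>[OF s], of V'] by (simp add: algebra_simps)
qed

lemma prime_on_eqI:
  assumes "s islimpt J" "(f has_vector_derivative d) (at s within J)"
  shows "prime_on J f s = d"
  unfolding prime_on_def using assms by (intro vector_derivative_within) (simp_all add: trivial_limit_within)

lemma bounded_bilinear_cross3: "bounded_bilinear cross3"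
  using bilinear_cross bilinear_conv_bounded_bilinear by blast

lemma bounded_bilinear_differentiable:
  assumes "bounded_bilinear B" "f differentiable (at x within T)" "h differentiable (at x within T)"
  shows "(\<lambda>t. B (f t) (h t)) differentiable (at x within T)"
  using assms bounded_bilinear.FDERIV unfolding differentiable_def by blast

text \<open>The surface seen in one chart: \<open>P\<close> and \<open>n\<close> are the local forms
  of the immersion and of the conormal, and \<open>C\<close> collects the Christoffel symbols of the
  induced connection. The structure equation is kept for constant fields only.\<close>

locale affine_sphere_chart =
  fixes S :: "(real^2) set" and P n :: "real^2 \<Rightarrow> real^3" and \<xi> :: "real^3"
    and g :: "real^2 \<Rightarrow> real^2 \<Rightarrow> real^2 \<Rightarrow> real" and C :: "real^2 \<Rightarrow> real^2 \<Rightarrow> real^2 \<Rightarrow> real^2"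
  assumes S: "open S" and P: "smooth_on P S"
    and gauss: "\<And>x v w. x \<in> S \<Longrightarrow>
      frechet_derivative (\<lambda>y. frechet_derivative P (at y) w) (at x) v
        = frechet_derivative P (at x) (C x v w) + g x v w *\<^sub>R \<xi>"
    and lorentz: "\<And>x. x \<in> S \<Longrightarrow> lorentzian (g x)"
    and gram: "\<And>x v w. x \<in> S \<Longrightarrow> sqrt ((g x v w)\<^sup>2 - g x v v * g x w w)
      = \<bar>bracket (frechet_derivative P (at x) v) (frechet_derivative P (at x) w) \<xi>\<bar>"
    and n_\<xi>: "\<And>x. x \<in> S \<Longrightarrow> n x \<bullet> \<xi> = 1"
    and n_tangent: "\<And>x v. x \<in> S \<Longrightarrow> n x \<bullet> frechet_derivative P (at x) v = 0"
begin

abbreviation L :: "real^2 \<Rightarrow> real^2 \<Rightarrow> real^3" where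
  "L x v \<equiv> frechet_derivative P (at x) v"

abbreviation e1 :: "real^2" where "e1 \<equiv> axis 1 1"
abbreviation e2 :: "real^2" where "e2 \<equiv> axis 2 1"

section \<open>Structure equations of the affine sphere in a chart\<close>

lemma bilinear_g: "x \<in> S \<Longrightarrow> bilinear (g x)"
  and sym_g: "x \<in> S \<Longrightarrow> g x v w = g x w v"
  using lorentz unfolding lorentzian_def by blast+

lemma linear_L: "x \<in> S \<Longrightarrow> linear (L x)"
  using smooth_on_differentiable[OF P] linear_frechet_derivative by blast

lemma smooth_L: "smooth_on (\<lambda>x. L x v) S"
  by (rule smooth_on_frechet_derivative[OF P])

text \<open>Some bracket with \<xi> is nonzero by the volume condition, and all of them are
  multiples of this one. Hence the tangent frame and \<xi> form a basis.\<close>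

lemma frame_nonzero:
  assumes x: "x \<in> S"
  shows "bracket (L x e1) (L x e2) \<xi> \<noteq> 0"
proof -
  obtain v w where "bracket (L x v) (L x w) \<xi> \<noteq> 0"
    using lorentzian_gram_bracket(2)[OF lorentz[OF x] gram[OF x]] by blast
  then show ?thesis using bracket_linear_image[OF linear_L[OF x], of v w \<xi>] by auto
qed

text \<open>Recovers a vector from its pairings with the frame. This turns regularity of the
  pairings into regularity of the conormal and, along a curve, of its derivative.\<close>

lemma dual_frame_expansion:
  assumes "x \<in> S"
  shows "z = (1 / (L x e1 \<bullet> cross3 (L x e2) \<xi>)) *\<^sub>R ((z \<bullet> L x e1) *\<^sub>R cross3 (L x e2) \<xi>
    + (z \<bullet> L x e2) *\<^sub>R cross3 \<xi> (L x e1) + (z \<bullet> \<xi>) *\<^sub>R cross3 (L x e1) (L x e2))"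
  using frame_nonzero[OF assms] bracket_dual_expansion[of "L x e1" "L x e2" \<xi> z, symmetric]
  by (simp add: bracket_eq_cross)

text \<open>The conormal is given only by equations. Solving them expresses it as a normalised cross
  product of tangent vectors, which is differentiable.\<close>

lemma n_differentiable:
  assumes "x \<in> S"
  shows "n differentiable (at x)"
proof -
  let ?m = "\<lambda>x. (1 / (L x e1 \<bullet> cross3 (L x e2) \<xi>)) *\<^sub>R cross3 (L x e1) (L x e2)"
  have d: "(\<lambda>x. L x v) differentiable (at x)" for v
    by (rule smooth_on_differentiable[OF smooth_L assms])
  have "?m differentiable (at x)"
    using frame_nonzero[OF assms]
    by (intro bounded_bilinear_differentiable[OF bounded_bilinear_scaleR]
        bounded_bilinear_differentiable[OF bounded_bilinear_cross3] differentiable_divide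
        bounded_bilinear_differentiable[OF bounded_bilinear_inner] d differentiable_const)
      (simp add: bracket_eq_cross)
  then obtain D where "(?m has_derivative D) (at x)" by (auto simp: differentiable_def)
  moreover have "?m y = n y" if "y \<in> S" for y
    using dual_frame_expansion[OF that, of "n y"] n_tangent[OF that] n_\<xi>[OF that] by simp
  ultimately have "(n has_derivative D) (at x)"
    using has_derivative_transform_within_open[OF _ S assms] by blast
  then show ?thesis by (auto simp: differentiable_def)
qed

lemma n_has_derivative:
  "x \<in> S \<Longrightarrow> (n has_derivative frechet_derivative n (at x)) (at x)"
  using n_differentiable frechet_derivative_works by blast

text \<open>Pairing the structure equation with \<open>n\<close> removes the tangential part and
  leaves the coefficient of \<xi>.\<close>

lemma g_eq: "x \<in> S \<Longrightarrow> g x v w = n x \<bullet> frechet_derivative (\<lambda>y. L y w) (at x) v"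
  by (simp add: gauss inner_add_right n_tangent n_\<xi>)

lemma dn_\<xi>:
  assumes x: "x \<in> S"
  shows "frechet_derivative n (at x) u \<bullet> \<xi> = 0"
proof -
  have "((\<lambda>y. n y \<bullet> \<xi>) has_derivative (\<lambda>u. frechet_derivative n (at x) u \<bullet> \<xi>)) (at x)"
    by (intro has_derivative_inner_left n_has_derivative x)
  from frechet_derivative_at[OF this] show ?thesis
    using frechet_derivative_cong_open[OF S x, of "\<lambda>y. n y \<bullet> \<xi>" "\<lambda>_. 1"] n_\<xi>
    by (simp add: fun_eq_iff)
qed

text \<open>Differentiating the orthogonality of \<open>n\<close> to the tangent plane gives the
  relation h = - <dN, d\<psi>>.\<close>

lemma dn_tangent:
  assumes x: "x \<in> S"
  shows "frechet_derivative n (at x) u \<bullet> L x w = - g x u w"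
proof -
  have "((\<lambda>y. n y \<bullet> L y w) has_derivative (\<lambda>u. n x \<bullet> frechet_derivative (\<lambda>y. L y w) (at x) u
      + frechet_derivative n (at x) u \<bullet> L x w)) (at x)"
    by (intro has_derivative_inner n_has_derivative smooth_on_has_derivative[OF smooth_L] x)
  from frechet_derivative_at[OF this] show ?thesis
    using frechet_derivative_cong_open[OF S x, of "\<lambda>y. n y \<bullet> L y w" "\<lambda>_. 0"] n_tangent g_eq[OF x]
    by (simp add: fun_eq_iff add_eq_0_iff2)
qed

lemma dn_second_derivative:
  assumes x: "x \<in> S"
  shows "frechet_derivative n (at x) u \<bullet> frechet_derivative (\<lambda>y. L y w) (at x) v = - g x u (C x v w)"
  by (simp add: gauss[OF x] inner_add_right dn_\<xi>[OF x] dn_tangent[OF x])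

text \<open>Obtained by differentiating \<open>g_eq\<close>. The first term is a third derivative of
  \<open>P\<close>, whose symmetry yields the Codazzi equation.\<close>

lemma g_has_derivative:
  assumes x: "x \<in> S"
  shows "((\<lambda>y. g y v w) has_derivative (\<lambda>u. n x \<bullet>
        frechet_derivative (\<lambda>y. frechet_derivative (\<lambda>z. L z w) (at y) v) (at x) u
      - g x u (C x v w))) (at x)"
proof -
  have "((\<lambda>y. n y \<bullet> frechet_derivative (\<lambda>z. L z w) (at y) v) has_derivative
    (\<lambda>u. n x \<bullet> frechet_derivative (\<lambda>y. frechet_derivative (\<lambda>z. L z w) (at y) v) (at x) u
      + frechet_derivative n (at x) u \<bullet> frechet_derivative (\<lambda>z. L z w) (at x) v)) (at x)"
    by (intro has_derivative_inner n_has_derivative x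
        smooth_on_has_derivative[OF smooth_on_frechet_derivative[OF smooth_L]])
  then have "((\<lambda>y. g y v w) has_derivative
    (\<lambda>u. n x \<bullet> frechet_derivative (\<lambda>y. frechet_derivative (\<lambda>z. L z w) (at y) v) (at x) u
      + frechet_derivative n (at x) u \<bullet> frechet_derivative (\<lambda>z. L z w) (at x) v)) (at x)"
    by (rule has_derivative_transform_within_open[OF _ S x]) (simp add: g_eq)
  then show ?thesis by (simp add: dn_second_derivative[OF x])
qed

lemma g_differentiable: "x \<in> S \<Longrightarrow> (\<lambda>y. g y v w) differentiable (at x)"
  using g_has_derivative differentiable_def by blast

text \<open>In the difference the third derivatives of \<open>P\<close> cancel by symmetry, which
  leaves the terms with \<open>C\<close>.\<close>

lemma codazzi:
  assumes x: "x \<in> S"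
  shows "frechet_derivative (\<lambda>y. g y v w) (at x) v - frechet_derivative (\<lambda>y. g y v v) (at x) w
    = g x (C x v v) w - g x v (C x v w)"
proof -
  \<comment> \<open>Torsion-freeness of the induced connection, in the form paired with
    \<open>v\<close>; it comes from the symmetry of the second derivative of
    \<open>P\<close>.\<close>
  have sym_C: "g x v (C x w v) = g x v (C x v w)"
    using dn_second_derivative[OF x, of v w v] dn_second_derivative[OF x, of v v w]
      frechet_derivative_symmetric[OF S x P, of v w] by simp
  \<comment> \<open>After the swap both third derivatives are second derivatives of the same map
    \<open>\<lambda>z. L z v\<close>, in the directions \<open>v\<close> and
    \<open>w\<close>.\<close>
  have "frechet_derivative (\<lambda>y. g y v w) (at x) v = frechet_derivative (\<lambda>y. g y w v) (at x) v"
    by (rule fun_cong[OF frechet_derivative_cong_open[OF S x sym_g]])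
  also have "\<dots> = n x \<bullet> frechet_derivative (\<lambda>y. frechet_derivative (\<lambda>z. L z v) (at y) w) (at x) v
      - g x v (C x w v)"
    using fun_cong[OF frechet_derivative_at[OF g_has_derivative[OF x, of w v]], of v] by simp
  finally show ?thesis
    using fun_cong[OF frechet_derivative_at[OF g_has_derivative[OF x, of v v]], of w]
      frechet_derivative_symmetric[OF S x smooth_L, of v w v] sym_g[OF x, of w] sym_C
    by simp
qed

text \<open>The pointwise equivalence for a curve in one chart: both brackets are expressed by
  velocity and accelerations and then compared by \<open>bracket_eq_iff_parallel\<close>. The set
  \<open>J\<close> will be the preimage of a chart domain, so it need not be connected; the limit
  point hypothesis makes derivatives within it unique.\<close>

lemma bracket_eq_iff_acceleration_parallel:
  assumes G: "levi_civita S g G"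
    and \<gamma>S: "\<And>t. t \<in> J \<Longrightarrow> \<gamma> t \<in> S" and \<gamma>: "real_analytic_on \<gamma> J"
    and J: "\<And>t. t \<in> J \<Longrightarrow> t islimpt J" and s: "s \<in> J"
    and regular: "prime_on J \<gamma> s \<noteq> 0"
  defines "\<alpha> \<equiv> \<lambda>t. P (\<gamma> t)" and "U \<equiv> \<lambda>t. n (\<gamma> t)"
  shows "bracket (prime_on J \<alpha> s) (prime_on J (prime_on J \<alpha>) s) \<xi>
      = bracket (U s) (prime_on J U s) (prime_on J (prime_on J U) s)
    \<longleftrightarrow> (\<exists>\<mu>. curve_acceleration G J \<gamma> s = \<mu> *\<^sub>R prime_on J \<gamma> s)"
proof -
  define v where "v = prime_on J \<gamma>"
  define a where "a = prime_on J v s"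
  define x where "x = \<gamma> s"
  have x: "x \<in> S" unfolding x_def by (rule \<gamma>S[OF s])
  have \<gamma>': "(\<gamma> has_vector_derivative v t) (at t within J)" if "t \<in> J" for t
    using real_analytic_on_twice_differentiable(1)[OF \<gamma> J that]
    unfolding v_def prime_on_def by (simp add: vector_derivative_works)
  have v': "(v has_vector_derivative a) (at s within J)"
    using real_analytic_on_twice_differentiable(2)[OF \<gamma> J s]
    unfolding a_def v_def prime_on_def[abs_def] by (simp add: vector_derivative_works)
  have \<alpha>': "prime_on J \<alpha> t = L (\<gamma> t) (v t)" if "t \<in> J" for t
    unfolding \<alpha>_def using that
    by (intro prime_on_eqI J has_vector_derivative_compose_at \<gamma>' smooth_on_differentiable[OF P] \<gamma>S)
  have "((\<lambda>t. L (\<gamma> t) (v t)) has_vector_derivative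
      L x a + frechet_derivative (\<lambda>y. L y (v s)) (at x) (v s)) (at s within J)"
    unfolding x_def by (rule has_vector_derivative_frechet_along[OF S P \<gamma>S s \<gamma>'[OF s] v'])
  then have "(prime_on J \<alpha> has_vector_derivative
      L x a + frechet_derivative (\<lambda>y. L y (v s)) (at x) (v s)) (at s within J)"
    by (rule has_vector_derivative_transform[OF s, rotated]) (rule \<alpha>')
  then have "prime_on J (prime_on J \<alpha>) s = L x a + frechet_derivative (\<lambda>y. L y (v s)) (at x) (v s)"
    by (rule prime_on_eqI[OF J[OF s]])
  \<comment> \<open>The structure equation splits the second derivative into the acceleration for
    the induced connection and a multiple of \<xi>.\<close>
  then have \<alpha>'': "prime_on J (prime_on J \<alpha>) s
      = L x (a + C x (v s) (v s)) + g x (v s) (v s) *\<^sub>R \<xi>"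
    by (simp add: gauss[OF x] linear_add[OF linear_L[OF x]] add.assoc)
  have U': "prime_on J U t = frechet_derivative n (at (\<gamma> t)) (v t)" if "t \<in> J" for t
    unfolding U_def using that
    by (intro prime_on_eqI J has_vector_derivative_compose_at \<gamma>' n_differentiable \<gamma>S)
  define U1 where "U1 = prime_on J U"
  have U1_L: "U1 t \<bullet> L (\<gamma> t) w = - g (\<gamma> t) (v t) w" if "t \<in> J" for t w
    unfolding U1_def U'[OF that] by (rule dn_tangent[OF \<gamma>S[OF that]])
  have L_along: "((\<lambda>t. L (\<gamma> t) w) has_vector_derivative
      frechet_derivative (\<lambda>y. L y w) (at x) (v s)) (at s within J)" for w
    unfolding x_def
    by (rule has_vector_derivative_compose_at[OF \<gamma>'[OF s] smooth_on_differentiable[OF smooth_L \<gamma>S[OF s]]])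
  have g_along: "((\<lambda>t. g (\<gamma> t) (v t) w) has_vector_derivative
      g x a w + frechet_derivative (\<lambda>y. g y (v s) w) (at x) (v s)) (at s within J)" for w
  proof -
    have lin: "linear (frechet_derivative (\<lambda>y. g y (v s) w) (at x))"
      using g_differentiable[OF x] by (rule linear_frechet_derivative)
    show ?thesis
      using has_derivative_metric[OF S bilinear_g g_differentiable \<gamma>S s
          \<gamma>'[OF s, unfolded has_vector_derivative_def] v'[unfolded has_vector_derivative_def]
          has_derivative_const[of w]]
      unfolding has_vector_derivative_def x_def[symmetric]
      by (simp add: linear_cmul[OF lin] bilinear_lmul[OF bilinear_g[OF x]]
          bilinear_rzero[OF bilinear_g[OF x]] distrib_left)
  qed
  have "U1 differentiable (at s within J)"
  proof -
    \<comment> \<open>The coefficients of \<open>U'\<close> in the frame dual to \<open>L e1, L e2, \<xi>\<close> involve no derivative of \<open>n\<close>.\<close>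
    let ?m = "\<lambda>t. (1 / (L (\<gamma> t) e1 \<bullet> cross3 (L (\<gamma> t) e2) \<xi>)) *\<^sub>R
      ((- g (\<gamma> t) (v t) e1) *\<^sub>R cross3 (L (\<gamma> t) e2) \<xi>
        + (- g (\<gamma> t) (v t) e2) *\<^sub>R cross3 \<xi> (L (\<gamma> t) e1))"
    have d: "(\<lambda>t. L (\<gamma> t) w) differentiable (at s within J)"
      "(\<lambda>t. g (\<gamma> t) (v t) w) differentiable (at s within J)" for w
      using L_along g_along by (blast intro: differentiableI_vector)+
    have "?m differentiable (at s within J)"
      using frame_nonzero[OF x]
      by (intro bounded_bilinear_differentiable[OF bounded_bilinear_scaleR] differentiable_add
          bounded_bilinear_differentiable[OF bounded_bilinear_cross3] differentiable_divide
          bounded_bilinear_differentiable[OF bounded_bilinear_inner] d differentiable_const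
          differentiable_minus)
        (simp add: bracket_eq_cross x_def)
    moreover have "U1 t = ?m t" if "t \<in> J" for t
    proof -
      have "U1 t \<bullet> \<xi> = 0" unfolding U1_def U'[OF that] by (rule dn_\<xi>[OF \<gamma>S[OF that]])
      then show ?thesis
        using dual_frame_expansion[OF \<gamma>S[OF that], of "U1 t"]
        by (simp only: U1_L[OF that] scaleR_zero_left add_0_right)
    qed
    ultimately show ?thesis
      unfolding differentiable_def using has_derivative_transform[OF s, of U1 ?m] by blast
  qed
  then obtain U2 where U1': "(U1 has_vector_derivative U2) (at s within J)"
    by (metis vector_derivative_works)
  have U'': "prime_on J (prime_on J U) s = U2"
    using prime_on_eqI[OF J[OF s] U1'] by (simp add: U1_def)
  \<comment> \<open>The function \<open>U1 t \<bullet> L (\<gamma> t) w\<close> is differentiated in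
    two ways: by the product rule, and as minus the metric along the curve.\<close>
  have U2_L: "U2 \<bullet> L x w = g x (a + C x (v s) (v s)) w - 2 * g x (a + G x (v s) (v s)) w" for w
  proof -
    have "((\<lambda>t. U1 t \<bullet> L (\<gamma> t) w) has_vector_derivative
        U1 s \<bullet> frechet_derivative (\<lambda>y. L y w) (at x) (v s) + U2 \<bullet> L (\<gamma> s) w) (at s within J)"
      by (rule bounded_bilinear.has_vector_derivative[OF bounded_bilinear_inner U1' L_along])
    moreover have "((\<lambda>t. U1 t \<bullet> L (\<gamma> t) w) has_vector_derivative
        - (g x a w + frechet_derivative (\<lambda>y. g y (v s) w) (at x) (v s))) (at s within J)"
      by (rule has_vector_derivative_transform[OF s _ has_vector_derivative_minus[OF g_along]])
        (rule U1_L)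
    ultimately have "U1 s \<bullet> frechet_derivative (\<lambda>y. L y w) (at x) (v s) + U2 \<bullet> L x w
        = - (g x a w + frechet_derivative (\<lambda>y. g y (v s) w) (at x) (v s))"
      unfolding x_def[symmetric] using J[OF s]
      by (intro vector_derivative_unique_within) (auto simp: trivial_limit_within)
    moreover have "U1 s \<bullet> frechet_derivative (\<lambda>y. L y w) (at x) (v s) = - g x (v s) (C x (v s) w)"
      unfolding U1_def U'[OF s] x_def[symmetric] by (rule dn_second_derivative[OF x])
    \<comment> \<open>Codazzi replaces the term containing \<open>C x (v s) w\<close> by one
      containing \<open>C x (v s) (v s)\<close>. The remaining derivatives of \<open>g\<close>
      combine to \<open>- 2 * g x (G x (v s) (v s)) w\<close> by the Koszul identity.\<close>
    ultimately show ?thesis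
      using codazzi[OF x, of "v s" w]
        levi_civita_constant_fields(1)[OF G x, of "v s" w "v s"]
        levi_civita_constant_fields(1)[OF G x, of "v s" "v s" w]
        levi_civita_constant_fields(2)[OF G x, of w "v s"]
        sym_g[OF x, of "G x (v s) w" "v s"]
      by (simp add: bilinear_ladd[OF bilinear_g[OF x]])
  qed
  have "bracket (L x (v s)) (L x (a + C x (v s) (v s)) + g x (v s) (v s) *\<^sub>R \<xi>) \<xi>
      = bracket (U s) (U1 s) U2 \<longleftrightarrow> (\<exists>\<mu>. a + G x (v s) (v s) = \<mu> *\<^sub>R v s)"
    by (rule bracket_eq_iff_parallel[OF linear_L[OF x] lorentz[OF x] gram[OF x]])
      (use n_\<xi>[OF x] n_tangent[OF x] U1_L[OF s] U2_L regular in \<open>auto simp: U_def x_def v_def\<close>)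
  then show ?thesis
    unfolding U'' \<alpha>'' \<alpha>'[OF s] by (simp add: curve_acceleration_def x_def v_def a_def U1_def)
qed

end

subsection \<open>Passage from charts to the surface\<close>

lemma prime_on_cong:
  assumes "\<And>s. s \<in> J \<Longrightarrow> f s = g s" "t \<in> J"
  shows "prime_on J f t = prime_on J g t"
  unfolding prime_on_def using assms by (intro vector_derivative_cong_eq) auto

text \<open>\<open>J\<close> is relatively open in \<open>I\<close>, so both sets induce the same
  filter at each point of \<open>J\<close>. For second derivatives the first ones must agree on all
  of \<open>J\<close>.\<close>

lemma prime_on_Int_open:
  assumes J: "J = I \<inter> T" "open T" and t: "t \<in> J"
  shows "prime_on I f t = prime_on J f t"
    and "prime_on I (prime_on I f) t = prime_on J (prime_on J f) t"
    and "curve_acceleration G I \<gamma> t = curve_acceleration G J \<gamma> t"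
proof -
  have at: "at s within I = at s within J" if "s \<in> J" for s
    using that J by (intro at_within_nhd[of s T]) auto
  have first: "prime_on I f s = prime_on J f s" if "s \<in> J" for s and f :: "real \<Rightarrow> 'z::real_normed_vector"
    unfolding prime_on_def at[OF that] ..
  have second: "prime_on I (prime_on I f) t = prime_on J (prime_on J f) t"
    for f :: "real \<Rightarrow> 'z::real_normed_vector"
    unfolding first[OF t] by (rule prime_on_cong[OF first t])
  show "prime_on I f t = prime_on J f t" by (rule first[OF t])
  show "prime_on I (prime_on I f) t = prime_on J (prime_on J f) t" by (rule second)
  show "curve_acceleration G I \<gamma> t = curve_acceleration G J \<gamma> t"
    by (simp only: curve_acceleration_def second[of \<gamma>] first[OF t, of \<gamma>])
qed

lemma is_chart_in_chart:
  assumes "is_chart M c" "p \<in> fst c"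
  shows "in_chart c F (snd c p) = F p"
proof -
  have "topspace (subtopology M (fst c)) = fst c"
    using assms(1) openin_subset[of M "fst c"] unfolding is_chart_def by auto
  then have "inj_on (snd c) (fst c)"
    using assms(1) homeomorphic_imp_injective_map unfolding is_chart_def by metis
  then show ?thesis using assms(2) by (simp add: in_chart_def)
qed

text \<open>Applied to constant fields, the defining equation of the affine metric loses its
  coordinate derivatives and leaves the Christoffel symbols \<open>C\<close>.\<close>

lemma affine_sphere_chart_exists:
  assumes "is_chart M c" "c \<in> A"
    and sphere: "indefinite_improper_affine_sphere A \<psi> \<xi> h" and N: "affine_conormal A \<psi> \<xi> N"
  shows "\<exists>C. affine_sphere_chart (chart_image c) (in_chart c \<psi>) (in_chart c N) \<xi> (h c) C"
proof -
  let ?S = "chart_image c" and ?P = "in_chart c \<psi>"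
  obtain C where C: "\<And>X Y x. smooth_on X ?S \<Longrightarrow> smooth_on Y ?S \<Longrightarrow> x \<in> ?S \<Longrightarrow>
      frechet_derivative (\<lambda>y. frechet_derivative ?P (at y) (Y y)) (at x) (X x)
        = frechet_derivative ?P (at x) (connection C X Y x) + h c x (X x) (Y x) *\<^sub>R \<xi>"
    using sphere \<open>c \<in> A\<close> unfolding indefinite_improper_affine_sphere_def affine_metric_def by meson
  have "affine_sphere_chart ?S ?P (in_chart c N) \<xi> (h c) C"
  proof
    show "open ?S" using assms(1) by (simp add: is_chart_def)
    show "smooth_on ?P ?S"
      using sphere \<open>c \<in> A\<close> unfolding indefinite_improper_affine_sphere_def smooth_immersion_def by blast
    fix x assume x: "x \<in> ?S"
    show "frechet_derivative (\<lambda>y. frechet_derivative ?P (at y) w) (at x) v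
        = frechet_derivative ?P (at x) (C x v w) + h c x v w *\<^sub>R \<xi>" for v w
      using C[OF smooth_on_const[of v] smooth_on_const[of w] x] by (simp add: connection_def)
    show "lorentzian (h c x)" and "sqrt ((h c x v w)\<^sup>2 - h c x v v * h c x w w)
      = \<bar>bracket (frechet_derivative ?P (at x) v) (frechet_derivative ?P (at x) w) \<xi>\<bar>" for v w
      using sphere \<open>c \<in> A\<close> x unfolding indefinite_improper_affine_sphere_def by blast+
    show "in_chart c N x \<bullet> \<xi> = 1" and "in_chart c N x \<bullet> frechet_derivative ?P (at x) v = 0" for v
      using N \<open>c \<in> A\<close> x unfolding affine_conormal_def by blast+
  qed
  then show ?thesis by blast
qed

theorem theorem4p3:
  fixes M :: "'p topology" and A :: "'p chart set"
    and \<psi> N :: "'p \<Rightarrow> real^3" and \<xi> :: "real^3"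
    and h :: "'p chart \<Rightarrow> real^2 \<Rightarrow> real^2 \<Rightarrow> real^2 \<Rightarrow> real"
    and I :: "real set" and \<beta> :: "real \<Rightarrow> 'p"
    and \<alpha> U :: "real \<Rightarrow> real^3"
  assumes "analytic_surface M A"
    and "indefinite_improper_affine_sphere A \<psi> \<xi> h"
    and "affine_conormal A \<psi> \<xi> N"
    and "is_interval I" and "interior I \<noteq> {}"
    and "regular_analytic_curve M A I \<beta>"
    and "\<alpha> = \<psi> \<circ> \<beta>" and "U = N \<circ> \<beta>"
  shows "pre_geodesic A h I \<beta> \<longleftrightarrow>
    (\<forall>t\<in>I. bracket (prime_on I \<alpha> t) (prime_on I (prime_on I \<alpha>) t) \<xi>
         = bracket (U t) (prime_on I U t) (prime_on I (prime_on I U) t))"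
proof -
  let ?eq = "\<lambda>t. bracket (prime_on I \<alpha> t) (prime_on I (prime_on I \<alpha>) t) \<xi>
         = bracket (U t) (prime_on I U t) (prime_on I (prime_on I U) t)"
  have chart: "is_chart M c" if "c \<in> A" for c
    using assms(1) that by (simp add: analytic_surface_def)
  have \<beta>: "continuous_map (top_of_set I) M \<beta>"
    using assms(6) by (simp add: regular_analytic_curve_def)
  have covered: "\<exists>c\<in>A. \<beta> t \<in> fst c" if "t \<in> I" for t
    using assms(1) continuous_map_image_subset_topspace[OF \<beta>] that
    unfolding analytic_surface_def by auto
  have limit: "t islimpt I" if "t \<in> I" for t
  proof (rule connected_imp_perfect[OF _ that])
    \<comment> \<open>An interval with nonempty interior is connected and not a single point, hence
      has no isolated points.\<close>
    show "connected I" using assms(4) by (rule is_interval_connected)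
    show "I \<noteq> {x}" for x using assms(5) by auto
  qed
  \<comment> \<open>The right side mentions neither the chart nor the connection. Proportionality in
    one chart around a point therefore gives the identity there, and the identity gives
    proportionality in every chart around the point.\<close>
  have key: "(\<exists>\<mu>. curve_acceleration G I (snd c \<circ> \<beta>) t = \<mu> *\<^sub>R prime_on I (snd c \<circ> \<beta>) t) \<longleftrightarrow> ?eq t"
    if c: "c \<in> A" and G: "levi_civita (chart_image c) (h c) G" and t: "t \<in> I" "\<beta> t \<in> fst c" for c G t
  proof -
    obtain C where "affine_sphere_chart (chart_image c) (in_chart c \<psi>) (in_chart c N) \<xi> (h c) C"
      using affine_sphere_chart_exists[OF chart[OF c] c assms(2,3)] by blast
    then interpret affine_sphere_chart "chart_image c" "in_chart c \<psi>" "in_chart c N" \<xi> "h c" C .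
    \<comment> \<open>The chart sees the curve only on this preimage, which is relatively open in
      \<open>I\<close> by continuity of \<beta>.\<close>
    define J where "J = {s\<in>I. \<beta> s \<in> fst c}"
    have "openin (top_of_set I) J"
      using openin_continuous_map_preimage[OF \<beta>, of "fst c"] chart[OF c] by (simp add: is_chart_def J_def)
    then obtain T where J: "J = I \<inter> T" "open T" by (auto simp: openin_open)
    have tJ: "t \<in> J" using t by (simp add: J_def)
    have lim: "s islimpt J" if "s \<in> J" for s
      unfolding J(1) using limit[of s] that J
      by (intro islimpt_Int_eventually eventually_at_in_open') auto
    have \<alpha>: "\<alpha> s = in_chart c \<psi> ((snd c \<circ> \<beta>) s)" and U: "U s = in_chart c N ((snd c \<circ> \<beta>) s)"
      if "s \<in> J" for s
      using that assms(7,8) by (simp_all add: J_def is_chart_in_chart[OF chart[OF c]])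
    have prime: "prime_on J f t = prime_on J f' t"
      "prime_on J (prime_on J f) t = prime_on J (prime_on J f') t"
      if "\<And>s. s \<in> J \<Longrightarrow> f s = f' s" for f f' :: "real \<Rightarrow> real^3"
      using that tJ by (auto intro!: prime_on_cong)
    have "snd c (\<beta> s) \<in> chart_image c" if "s \<in> J" for s
      using that by (simp add: J_def chart_image_def)
    moreover have "real_analytic_on (snd c \<circ> \<beta>) J" and "prime_on J (snd c \<circ> \<beta>) t \<noteq> 0"
      using assms(6) c t unfolding regular_analytic_curve_def J_def
      by (blast, unfold prime_on_Int_open(1)[OF J tJ, symmetric, unfolded J_def], blast)
    ultimately show ?thesis
      using bracket_eq_iff_acceleration_parallel[OF G, of J "snd c \<circ> \<beta>" t] lim tJ
      by (simp add: prime_on_Int_open(3)[OF J tJ] prime_on_Int_open(1)[OF J tJ, of "snd c \<circ> \<beta>"]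
          prime_on_Int_open(1,2)[OF J tJ, of \<alpha>] prime_on_Int_open(1,2)[OF J tJ, of U]
          prime[OF \<alpha>] prime[OF U] U[OF tJ])
  qed
  show ?thesis
  proof
    assume "pre_geodesic A h I \<beta>"
    then show "\<forall>t\<in>I. ?eq t"
      unfolding pre_geodesic_def using key covered by meson
  next
    assume eq: "\<forall>t\<in>I. ?eq t"
    \<comment> \<open>\<open>pre_geodesic\<close> asks for a Levi-Civita connection in every chart
      of \<open>A\<close>, including charts that the curve does not meet, so existence is proved
      independently of \<beta>.\<close>
    have "\<exists>G. levi_civita (chart_image c) (h c) G" if c: "c \<in> A" for c
    proof -
      obtain C where "affine_sphere_chart (chart_image c) (in_chart c \<psi>) (in_chart c N) \<xi> (h c) C"
        using affine_sphere_chart_exists[OF chart[OF c] c assms(2,3)] by blast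
      then interpret affine_sphere_chart "chart_image c" "in_chart c \<psi>" "in_chart c N" \<xi> "h c" C .
      show ?thesis by (rule levi_civita_exists[OF S lorentz g_differentiable])
    qed
    then obtain G where "\<And>c. c \<in> A \<Longrightarrow> levi_civita (chart_image c) (h c) (G c)" by metis
    then show "pre_geodesic A h I \<beta>"
      unfolding pre_geodesic_def using key eq by blast
  qed
qed

end
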